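(* Let $\Omega\subset\mathbb{R}^3$ be a connected polyhedral domain and $\varrho>0$. There exists a constant $C_*>0$ depending only on $\Omega$ and $\varrho$ such that, for every polyhedral mesh $\mathcal{M}_h$ of $\Omega$ with regularity parameter $\varrho$ and every collection $(\alpha_V)_{V\in\mathcal{V}_h}\in\mathbb{R}^{\mathcal{V}_h}$ of values at vertices, there is $C\in\mathbb{R}$ such that $$\sum_{T\in\mathcal{T}_h}h_T^3\sum_{V\in\mathcal{V}_T}(\alpha_V-C)^2\le C_*\sum_{T\in\mathcal{T}_h}h_T\sum_{E\in\mathcal{E}_T}\big|[\![\alpha_V]\!]_E\big|^2.$$
   Context: **Mesh.** $\Omega\subset\mathbb{R}^3$ is a connected (bounded, open) polyhedral domain. A polyhedral mesh $\mathcal{M}_h=\mathcal{T}_h\cup\mathcal{F}_h\cup\mathcal{E}_h\cup\mathcal{V}_h$ of $\Omega$ consists of: a finite set $\mathcal{T}_h$ of disjoint open polyhedra (elements) whose closures cover $\overline{\Omega}$; a finite set $\mathcal{F}_h$ of disjoint, relatively open, planar polygonal faces such that the boundary of each element is a union of closures of faces, each face lying either on the boundary of exactly two elements or on the boundary of exactly one element and on $\partial\Omega$; the set $\mathcal{E}_h$ of edges (open segments), the boundary of each face being a union of closures of edges; and the set $\mathcal{V}_h$ of vertices (endpoints of edges). For $T\in\mathcal{T}_h$, $\mathcal{E}_T$ and $\mathcal{V}_T$ are the sets of edges and vertices contained in $\partial T$. The diameter of a mesh entity $Y$ is denoted by $h_Y$. Each edge $E$ carries a fixed unit tangent $\boldsymbol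 t_E$; if $\boldsymbol t_E$ points from the endpoint $V_1$ to the endpoint $V_2$ of $E$, then $[\![\alpha_V]\!]_E=\alpha_{V_2}-\alpha_{V_1}$. **Mesh regularity.** The mesh has regularity parameter $\varrho>0$ if it admits a matching tetrahedral submesh (a conforming tetrahedral mesh of $\Omega$ such that each tetrahedron lies in a single element and each simplicial face is either disjoint from, or contained in, any given mesh face) such that every tetrahedron $S$ of the submesh has inradius at least $\varrho h_S$ and, if $S\subset T\in\mathcal{T}_h$, $h_S\ge\varrho h_T$. It is assumed, for simplicity, that this submesh can be obtained by adding as new vertices only centers of faces and elements of $\mathcal{M}_h$.
   Formalization: Elements and faces are assumed to have connected boundaries (no cavities in elements, no holes in faces); without this the claim fails, e.g. for a cube with a cubic cavity as second element, with values 0 on the outer and 1 on the cavity vertices. *)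

theory Defs
  imports "HOL-Analysis.Analysis"
begin

text \<open>
  Polytopal sets (polyhedra for \<open>n = 3\<close>, planar polygons for \<open>n = 2\<close>) are relative interiors of
  finite unions of simplices; they need not be convex.  The condition on \<open>aff_dim\<close> puts all the
  simplices in one \<open>n\<close>-dimensional affine subspace.  In \<open>real ^ 3\<close> with \<open>n = 3\<close> the relative
  interior is the interior, so such a set is open, bounded and nonempty.
\<close>

definition polytopal_set :: "int \<Rightarrow> 'a::euclidean_space set \<Rightarrow> bool" where
  "polytopal_set n P \<longleftrightarrow>
     (\<exists>\<S>. finite \<S> \<and> (\<forall>S\<in>\<S>. n simplex S) \<and> aff_dim (\<Union>\<S>) = n \<and> P = rel_interior (\<Union>\<S>))"

text \<open>
  The unit tangent \<open>\<tau> E\<close> points from the endpoint \<open>V1\<close> to the endpoint \<open>V2\<close> of the open segment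
  \<open>E\<close>.  For vectors, \<open>sgn x = x /\<^sub>R norm x\<close>.
\<close>

definition oriented_edge ::
    "('a::euclidean_space set \<Rightarrow> 'a) \<Rightarrow> 'a set \<Rightarrow> 'a \<Rightarrow> 'a \<Rightarrow> bool" where
  "oriented_edge \<tau> E V1 V2 \<longleftrightarrow> V1 \<noteq> V2 \<and> E = open_segment V1 V2 \<and> \<tau> E = sgn (V2 - V1)"

definition edge_jump ::
    "('a::euclidean_space set \<Rightarrow> 'a) \<Rightarrow> ('a \<Rightarrow> real) \<Rightarrow> 'a set \<Rightarrow> real" where
  "edge_jump \<tau> \<alpha> E = (THE j. \<exists>V1 V2. oriented_edge \<tau> E V1 V2 \<and> j = \<alpha> V2 - \<alpha> V1)"

lemma oriented_edge_unique:
  assumes "oriented_edge \<tau> E V1 V2" "oriented_edge \<tau> E W1 W2"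
  shows "W1 = V1 \<and> W2 = V2"
proof -
  have "{V1, V2} = {W1, W2}"
    using assms unfolding oriented_edge_def by (metis open_segment_eq)
  moreover have False if "W1 = V2" "W2 = V1"
  proof -
    have "sgn (V2 - V1) = sgn (V1 - V2)"
      using assms that unfolding oriented_edge_def by metis
    then have "sgn (V2 - V1) = - sgn (V2 - V1)"
      by (metis minus_diff_eq sgn_minus)
    then have "sgn (V2 - V1) = 0"
      by (metis eq_neg_iff_add_eq_0 scaleR_2 scaleR_eq_0_iff zero_neq_numeral)
    then show False
      using assms(1) by (simp add: oriented_edge_def sgn_zero_iff)
  qed
  ultimately show ?thesis
    by (auto simp: doubleton_eq_iff)
qed

lemma edge_jump_eq:
  assumes "oriented_edge \<tau> E V1 V2"
  shows "edge_jump \<tau> \<alpha> E = \<alpha> V2 - \<alpha> V1"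
  unfolding edge_jump_def
  by (rule the_equality) (use assms oriented_edge_unique in blast)+

text \<open>
  Conventions:
  \<^item> The mesh entities (elements, faces, edges and vertices) are pairwise disjoint, and there are no
    edges other than the edges of the faces.
  \<^item> A polyhedron is a solid bounded by one polyhedral surface and a polygon is a region bounded by
    one polygonal contour: the boundaries of elements and of faces are connected.  For elements
    with cavities or faces with holes the edges of an element need not form a connected graph, and
    vertex values cannot be controlled by their differences along edges.
\<close>

definition polyhedral_mesh ::
    "(real ^ 3) set \<Rightarrow> (real ^ 3) set set \<Rightarrow> (real ^ 3) set set \<Rightarrow> (real ^ 3) set set
      \<Rightarrow> (real ^ 3) set \<Rightarrow> ((real ^ 3) set \<Rightarrow> real ^ 3) \<Rightarrow> bool" where
  "polyhedral_mesh \<Omega> \<T> \<F> \<E> \<V> \<tau> \<longleftrightarrow>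
     finite \<T> \<and> finite \<F> \<and> finite \<E> \<and>
     pairwise disjnt (\<T> \<union> \<F> \<union> \<E> \<union> (\<lambda>V. {V}) ` \<V>) \<and>
     (\<forall>T\<in>\<T>. polytopal_set 3 T \<and> connected T \<and> connected (frontier T)) \<and>
     (\<Union>T\<in>\<T>. closure T) = closure \<Omega> \<and>
     (\<forall>F\<in>\<F>. polytopal_set 2 F \<and> connected F \<and> connected (rel_frontier F)) \<and>
     (\<forall>T\<in>\<T>. \<exists>\<G>\<subseteq>\<F>. frontier T = (\<Union>F\<in>\<G>. closure F)) \<and>
     (\<forall>F\<in>\<F>. card {T \<in> \<T>. F \<subseteq> frontier T} = 2 \<or>
              card {T \<in> \<T>. F \<subseteq> frontier T} = 1 \<and> F \<subseteq> frontier \<Omega>) \<and>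
     (\<forall>E\<in>\<E>. \<exists>V1 V2. oriented_edge \<tau> E V1 V2) \<and>
     (\<forall>F\<in>\<F>. \<exists>\<D>\<subseteq>\<E>. rel_frontier F = (\<Union>E\<in>\<D>. closure E)) \<and>
     (\<forall>E\<in>\<E>. \<exists>F\<in>\<F>. E \<subseteq> rel_frontier F) \<and>
     \<V> = {V. \<exists>W. V \<noteq> W \<and> open_segment V W \<in> \<E>}"

definition edges_of :: "(real ^ 3) set set \<Rightarrow> (real ^ 3) set \<Rightarrow> (real ^ 3) set set" where
  "edges_of \<E> T = {E \<in> \<E>. E \<subseteq> frontier T}"

definition vertices_of :: "(real ^ 3) set \<Rightarrow> (real ^ 3) set \<Rightarrow> (real ^ 3) set" where
  "vertices_of \<V> T = {V \<in> \<V>. V \<in> frontier T}"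

definition inradius :: "'a::metric_space set \<Rightarrow> real" where
  "inradius S = Sup {r. 0 \<le> r \<and> (\<exists>x. ball x r \<subseteq> S)}"

text \<open>
  The tetrahedra of the submesh are represented by the closed simplices \<open>S\<close>; the corresponding
  open tetrahedron is \<open>interior S\<close>, and the open simplicial faces are the sets \<open>rel_interior K\<close>
  for \<open>K facet_of S\<close>.
\<close>

definition matching_submesh ::
    "(real ^ 3) set \<Rightarrow> (real ^ 3) set set \<Rightarrow> (real ^ 3) set set \<Rightarrow> (real ^ 3) set set \<Rightarrow> bool" where
  "matching_submesh \<Omega> \<T> \<F> \<S> \<longleftrightarrow>
     triangulation \<S> \<and> (\<forall>S\<in>\<S>. 3 simplex S) \<and> \<Union>\<S> = closure \<Omega> \<and>
     (\<forall>S\<in>\<S>. \<exists>T\<in>\<T>. interior S \<subseteq> T) \<and>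
     (\<forall>S\<in>\<S>. \<forall>K. K facet_of S \<longrightarrow>
        (\<forall>F\<in>\<F>. disjnt (rel_interior K) F \<or> rel_interior K \<subseteq> F))"

text \<open>
  Each face and each element has one center, which is an arbitrary point of it and may or may not
  be used as a new vertex.
\<close>

definition only_centers_added ::
    "(real ^ 3) set set \<Rightarrow> (real ^ 3) set set \<Rightarrow> (real ^ 3) set \<Rightarrow> (real ^ 3) set set \<Rightarrow> bool" where
  "only_centers_added \<T> \<F> \<V> \<S> \<longleftrightarrow>
     (\<exists>c. (\<forall>Y \<in> \<T> \<union> \<F>. c Y \<in> Y) \<and>
          \<V> \<subseteq> {v. \<exists>S\<in>\<S>. v extreme_point_of S} \<and>
          {v. \<exists>S\<in>\<S>. v extreme_point_of S} \<subseteq> \<V> \<union> c ` (\<T> \<union> \<F>))"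

definition mesh_regularity ::
    "real \<Rightarrow> (real ^ 3) set \<Rightarrow> (real ^ 3) set set \<Rightarrow> (real ^ 3) set set \<Rightarrow> (real ^ 3) set \<Rightarrow> bool" where
  "mesh_regularity \<rho> \<Omega> \<T> \<F> \<V> \<longleftrightarrow>
     0 < \<rho> \<and>
     (\<exists>\<S>. matching_submesh \<Omega> \<T> \<F> \<S> \<and>
          only_centers_added \<T> \<F> \<V> \<S> \<and>
          (\<forall>S\<in>\<S>. \<rho> * diameter S \<le> inradius S) \<and>
          (\<forall>S\<in>\<S>. \<forall>T\<in>\<T>. interior S \<subseteq> T \<longrightarrow> \<rho> * diameter T \<le> diameter S))"

end

theory Submission
  imports Defs
begin

text \<open>
  The vertex values are extended to a continuous function on the closed domain that is affine on
  every tetrahedron of the submesh, and the Poincare inequality of \<open>\<Omega>\<close> is applied to this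
  interpolant.  Both sides of the claim are then compared with integrals of the interpolant.

  \<^item> The Poincare inequality \<open>poincare_inequality\<close> is proved for pairs \<open>u\<close>, \<open>e\<close> in which \<open>e\<close> plays the
    part of \<open>\<bar>\<nabla>u\<bar>\<^sup>2\<close>.  On a convex set it follows by integrating along
    segments.  It spreads along chains of overlapping balls, which exist since \<open>\<Omega>\<close> is connected, and
    \<open>\<Omega>\<close> is up to a null set the union of finitely many open tetrahedra.  The constant is built from
    these sets, so it depends on \<open>\<Omega>\<close> only.

  \<^item> The value at the center of a face or of an element is defined to be the value at some vertex of
    that entity.  Thus the values at the vertices of a tetrahedron inside an element \<open>T\<close> are values at
    vertices of \<open>T\<close>.  Any two vertices of \<open>T\<close> are joined by a path of edges of \<open>T\<close>, because \<open>\<partial>T\<close> and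
    the contours of its faces are connected (\<open>element_vertices_connected\<close>).  The number of
    tetrahedra in \<open>T\<close>, and with it the length of a path, is bounded in terms of \<open>\<rho>\<close> by comparing
    volumes (\<open>card_simplices_of\<close>).  Hence the oscillation of the interpolant on a tetrahedron is
    controlled by the jumps along the edges of \<open>T\<close>, and an inscribed ball turns this into a bound on
    its slope (\<open>affine_on_imp_lipschitz\<close>, \<open>interpolant_energy\<close>).

  \<^item> Conversely the square of the value of an affine function at a vertex of a tetrahedron is at most a
    fixed multiple of its mean square over the tetrahedron (\<open>value_at_point_le_integral\<close>,
    \<open>vertex_sum_le_integral\<close>).
\<close>

section \<open>Poincare inequality on connected open sets\<close>

text \<open>
  An integrated form of \<open>\<bar>\<nabla>u\<bar>\<^sup>2 \<le> e\<close>: by the Cauchy-Schwarz inequality it holds for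
  \<open>e = \<bar>\<nabla>u\<bar>\<^sup>2\<close> if \<open>u\<close> is smooth.  It makes sense for functions that are only piecewise affine, also
  on segments that run inside a common face of two pieces.
\<close>

definition energy_density :: "'a::euclidean_space set \<Rightarrow> ('a \<Rightarrow> real) \<Rightarrow> ('a \<Rightarrow> ennreal) \<Rightarrow> bool" where
  "energy_density \<Omega> u e \<longleftrightarrow>
     u \<in> borel_measurable borel \<and> e \<in> borel_measurable borel \<and>
     (\<forall>x y. closed_segment x y \<subseteq> \<Omega> \<longrightarrow>
        ennreal ((u x - u y)\<^sup>2)
        \<le> ennreal ((dist x y)\<^sup>2) * (\<integral>\<^sup>+t\<in>{0..1}. e ((1 - t) *\<^sub>R x + t *\<^sub>R y) \<partial>lborel))"

lemma nn_integral_affine: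
  fixes f :: "'a::euclidean_space \<Rightarrow> ennreal"
  assumes [measurable]: "f \<in> borel_measurable borel" and "c > 0"
  shows "(\<integral>\<^sup>+x. f x \<partial>lborel) = ennreal (c ^ DIM('a)) * (\<integral>\<^sup>+x. f (a + c *\<^sub>R x) \<partial>lborel)"
proof -
  have "(\<integral>\<^sup>+x. f x \<partial>lborel)
      = (\<integral>\<^sup>+x. f x \<partial>density (distr lborel borel (\<lambda>x. a + c *\<^sub>R x)) (\<lambda>_. ennreal (\<bar>c\<bar> ^ DIM('a))))"
    using lborel_affine[of c a] \<open>c > 0\<close> by simp
  also have "\<dots> = ennreal (c ^ DIM('a)) * (\<integral>\<^sup>+x. f (a + c *\<^sub>R x) \<partial>lborel)"
    using \<open>c > 0\<close> by (simp add: nn_integral_density nn_integral_distr nn_integral_cmult)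
  finally show ?thesis .
qed

text \<open>
  The image of \<open>D\<close> under the homothety with center \<open>x\<close> and ratio \<open>t\<close> lies in \<open>D\<close>, and
  the Jacobian \<open>t ^ DIM('a)\<close> is bounded below since \<open>t \<ge> 1/2\<close>.
\<close>

lemma nn_integral_shrink_convex:
  fixes D :: "'a::euclidean_space set"
  assumes "convex D" and [measurable]: "D \<in> sets borel" "e \<in> borel_measurable borel"
    and "x \<in> D" "1/2 \<le> t" "t \<le> 1"
  shows "(\<integral>\<^sup>+y\<in>D. e ((1 - t) *\<^sub>R x + t *\<^sub>R y) \<partial>lborel) \<le> 2 ^ DIM('a) * (\<integral>\<^sup>+z\<in>D. e z \<partial>lborel)"
proof -
  let ?I = "\<integral>\<^sup>+y\<in>D. e ((1 - t) *\<^sub>R x + t *\<^sub>R y) \<partial>lborel"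
  have *: "ennreal (t ^ DIM('a)) * ?I \<le> (\<integral>\<^sup>+z\<in>D. e z \<partial>lborel)"
  proof -
    have "?I \<le> (\<integral>\<^sup>+y. e ((1 - t) *\<^sub>R x + t *\<^sub>R y) * indicator D ((1 - t) *\<^sub>R x + t *\<^sub>R y) \<partial>lborel)"
    proof (rule nn_integral_mono)
      fix y show "e ((1 - t) *\<^sub>R x + t *\<^sub>R y) * indicator D y
        \<le> e ((1 - t) *\<^sub>R x + t *\<^sub>R y) * indicator D ((1 - t) *\<^sub>R x + t *\<^sub>R y)"
        using convexD_alt[OF \<open>convex D\<close> \<open>x \<in> D\<close>, of y t] assms by (auto simp: indicator_def)
    qed
    then show ?thesis
      using nn_integral_affine[of "\<lambda>z. e z * indicator D z" t "(1 - t) *\<^sub>R x"] assms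
      by (simp add: mult_left_mono)
  qed
  have "1 \<le> (2 * t) ^ DIM('a)" using assms by (intro one_le_power) auto
  then have "?I \<le> ennreal (2 ^ DIM('a) * t ^ DIM('a)) * ?I"
    using mult_right_mono[OF ennreal_leI, of 1 "2 ^ DIM('a) * t ^ DIM('a)" ?I] by (simp add: power_mult_distrib)
  also have "\<dots> = 2 ^ DIM('a) * (ennreal (t ^ DIM('a)) * ?I)"
    using assms by (simp add: ennreal_mult' ennreal_power[symmetric] mult.assoc)
  also have "\<dots> \<le> 2 ^ DIM('a) * (\<integral>\<^sup>+z\<in>D. e z \<partial>lborel)"
    using * by (simp add: mult_left_mono)
  finally show ?thesis .
qed

text \<open>
  Integrating over the end of the segment that is farther from the point at parameter \<open>t\<close> is what
  would make the Jacobian small, so one integrates over \<open>y\<close> if \<open>t \<ge> 1/2\<close> and over \<open>x\<close>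
  otherwise.
\<close>

lemma nn_integral_segments_convex:
  fixes D :: "'a::euclidean_space set"
  assumes "convex D" and [measurable]: "D \<in> sets borel" "e \<in> borel_measurable borel"
    and t: "0 \<le> t" "t \<le> 1"
  shows "(\<integral>\<^sup>+x\<in>D. (\<integral>\<^sup>+y\<in>D. e ((1 - t) *\<^sub>R x + t *\<^sub>R y) \<partial>lborel) \<partial>lborel)
    \<le> 2 ^ DIM('a) * (\<integral>\<^sup>+z\<in>D. e z \<partial>lborel) * emeasure lborel D"
proof -
  let ?K = "2 ^ DIM('a) * (\<integral>\<^sup>+z\<in>D. e z \<partial>lborel)"
  have main: "(\<integral>\<^sup>+x\<in>D. (\<integral>\<^sup>+y\<in>D. e ((1 - s) *\<^sub>R x + s *\<^sub>R y) \<partial>lborel) \<partial>lborel) \<le> ?K * emeasure lborel D"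
    if "1/2 \<le> s" "s \<le> 1" for s
  proof -
    have "(\<integral>\<^sup>+x\<in>D. (\<integral>\<^sup>+y\<in>D. e ((1 - s) *\<^sub>R x + s *\<^sub>R y) \<partial>lborel) \<partial>lborel) \<le> (\<integral>\<^sup>+x\<in>D. ?K \<partial>lborel)"
      by (intro nn_integral_mono)
        (use nn_integral_shrink_convex[OF assms(1-3) _ that] in \<open>auto simp: indicator_def\<close>)
    then show ?thesis by (simp add: nn_integral_cmult_indicator)
  qed
  show ?thesis
  proof (cases "1/2 \<le> t")
    case True
    then show ?thesis using main t by blast
  next
    case False
    have "(\<integral>\<^sup>+x\<in>D. (\<integral>\<^sup>+y\<in>D. e ((1 - t) *\<^sub>R x + t *\<^sub>R y) \<partial>lborel) \<partial>lborel)
      = (\<integral>\<^sup>+x. (\<integral>\<^sup>+y. e ((1 - t) *\<^sub>R x + t *\<^sub>R y) * indicator D y * indicator D x \<partial>lborel) \<partial>lborel)"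
      by (simp add: nn_integral_multc)
    also have "\<dots> = (\<integral>\<^sup>+y. (\<integral>\<^sup>+x. e ((1 - t) *\<^sub>R x + t *\<^sub>R y) * indicator D y * indicator D x \<partial>lborel) \<partial>lborel)"
      by (rule lborel_pair.Fubini') simp
    also have "\<dots> = (\<integral>\<^sup>+y. (\<integral>\<^sup>+x. e ((1 - (1 - t)) *\<^sub>R y + (1 - t) *\<^sub>R x) * indicator D x * indicator D y \<partial>lborel) \<partial>lborel)"
      by (intro nn_integral_cong) (simp add: indicator_def add.commute)
    also have "\<dots> = (\<integral>\<^sup>+y\<in>D. (\<integral>\<^sup>+x\<in>D. e ((1 - (1 - t)) *\<^sub>R y + (1 - t) *\<^sub>R x) \<partial>lborel) \<partial>lborel)"
      by (simp add: nn_integral_multc)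
    also have "\<dots> \<le> ?K * emeasure lborel D"
      by (rule main) (use False t in auto)
    finally show ?thesis .
  qed
qed

definition difference_integral :: "('a::euclidean_space \<Rightarrow> real) \<Rightarrow> 'a set \<Rightarrow> 'a set \<Rightarrow> ennreal" where
  "difference_integral u A B = (\<integral>\<^sup>+x\<in>A. (\<integral>\<^sup>+y\<in>B. ennreal ((u x - u y)\<^sup>2) \<partial>lborel) \<partial>lborel)"

lemma difference_integral_convex:
  fixes D :: "'a::euclidean_space set"
  assumes "convex D" and [measurable]: "D \<in> sets borel" and "D \<subseteq> \<Omega>" "energy_density \<Omega> u e"
    and d: "\<And>x y. x \<in> D \<Longrightarrow> y \<in> D \<Longrightarrow> dist x y \<le> d"
  shows "difference_integral u D D
    \<le> ennreal (d\<^sup>2) * (2 ^ DIM('a) * (\<integral>\<^sup>+z\<in>D. e z \<partial>lborel) * emeasure lborel D)"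
proof -
  have [measurable]: "e \<in> borel_measurable borel" and seg: "\<And>x y. closed_segment x y \<subseteq> \<Omega> \<Longrightarrow>
        ennreal ((u x - u y)\<^sup>2) \<le> ennreal ((dist x y)\<^sup>2) * (\<integral>\<^sup>+t\<in>{0..1}. e ((1 - t) *\<^sub>R x + t *\<^sub>R y) \<partial>lborel)"
    using assms(4) by (auto simp: energy_density_def)
  let ?F = "\<lambda>x y t. e ((1 - t) *\<^sub>R x + t *\<^sub>R y) * indicator D x * indicator D y * indicator {0..1::real} t"
  have "difference_integral u D D
      = (\<integral>\<^sup>+x. (\<integral>\<^sup>+y. ennreal ((u x - u y)\<^sup>2) * indicator D y * indicator D x \<partial>lborel) \<partial>lborel)"
    unfolding difference_integral_def
    using assms(4) by (intro nn_integral_cong nn_integral_multc[symmetric]) (auto simp: energy_density_def)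
  also have "\<dots> \<le> (\<integral>\<^sup>+x. (\<integral>\<^sup>+y. (\<integral>\<^sup>+t. ennreal (d\<^sup>2) * ?F x y t \<partial>lborel) \<partial>lborel) \<partial>lborel)"
  proof (intro nn_integral_mono)
    fix x y :: 'a
    show "ennreal ((u x - u y)\<^sup>2) * indicator D y * indicator D x \<le> (\<integral>\<^sup>+t. ennreal (d\<^sup>2) * ?F x y t \<partial>lborel)"
    proof (cases "x \<in> D \<and> y \<in> D")
      case True
      then have "closed_segment x y \<subseteq> \<Omega>"
        using \<open>convex D\<close> \<open>D \<subseteq> \<Omega>\<close> by (meson closed_segment_subset order_trans)
      then have "ennreal ((u x - u y)\<^sup>2) \<le> ennreal ((dist x y)\<^sup>2) * (\<integral>\<^sup>+t\<in>{0..1}. e ((1 - t) *\<^sub>R x + t *\<^sub>R y) \<partial>lborel)"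
        by (rule seg)
      also have "\<dots> \<le> ennreal (d\<^sup>2) * (\<integral>\<^sup>+t\<in>{0..1}. e ((1 - t) *\<^sub>R x + t *\<^sub>R y) \<partial>lborel)"
        using True d by (intro mult_right_mono ennreal_leI power_mono) auto
      finally show ?thesis using True by (simp add: nn_integral_cmult)
    qed (auto simp: indicator_def)
  qed
  also have "\<dots> = ennreal (d\<^sup>2) * (\<integral>\<^sup>+x. (\<integral>\<^sup>+y. (\<integral>\<^sup>+t. ?F x y t \<partial>lborel) \<partial>lborel) \<partial>lborel)"
    by (simp add: nn_integral_cmult)
  also have "(\<integral>\<^sup>+x. (\<integral>\<^sup>+y. (\<integral>\<^sup>+t. ?F x y t \<partial>lborel) \<partial>lborel) \<partial>lborel)
      = (\<integral>\<^sup>+x. (\<integral>\<^sup>+t. (\<integral>\<^sup>+y. ?F x y t \<partial>lborel) \<partial>lborel) \<partial>lborel)"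
    by (intro nn_integral_cong lborel_pair.Fubini'[symmetric]) simp
  also have "\<dots> = (\<integral>\<^sup>+t. (\<integral>\<^sup>+x. (\<integral>\<^sup>+y. ?F x y t \<partial>lborel) \<partial>lborel) \<partial>lborel)"
    by (rule lborel_pair.Fubini'[symmetric]) simp
  also have "\<dots> \<le> (\<integral>\<^sup>+t\<in>{0..1::real}. 2 ^ DIM('a) * (\<integral>\<^sup>+z\<in>D. e z \<partial>lborel) * emeasure lborel D \<partial>lborel)"
  proof (intro nn_integral_mono)
    fix t :: real
    have "(\<integral>\<^sup>+x. (\<integral>\<^sup>+y. ?F x y t \<partial>lborel) \<partial>lborel)
      = (\<integral>\<^sup>+x\<in>D. (\<integral>\<^sup>+y\<in>D. e ((1 - t) *\<^sub>R x + t *\<^sub>R y) \<partial>lborel) \<partial>lborel) * indicator {0..1} t"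
      by (subst (2) nn_integral_multc[symmetric], simp, rule nn_integral_cong,
          subst nn_integral_multc[symmetric], simp, subst nn_integral_multc[symmetric], simp,
          rule nn_integral_cong) (simp add: indicator_def)
    then show "(\<integral>\<^sup>+x. (\<integral>\<^sup>+y. ?F x y t \<partial>lborel) \<partial>lborel)
      \<le> 2 ^ DIM('a) * (\<integral>\<^sup>+z\<in>D. e z \<partial>lborel) * emeasure lborel D * indicator {0..1} t"
      using nn_integral_segments_convex[OF assms(1), of e t] by (auto simp: indicator_def)
  qed
  also have "\<dots> = 2 ^ DIM('a) * (\<integral>\<^sup>+z\<in>D. e z \<partial>lborel) * emeasure lborel D"
    by (simp add: nn_integral_cmult_indicator)
  finally show ?thesis by (simp add: mult_left_mono)
qed


text \<open>
  The Poincare inequality is split into statements about pairs of sets in order to be chained; the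
  right-hand side always uses the energy of all of \<open>\<Omega>\<close>.
\<close>

definition poincare_pair :: "'a::euclidean_space set \<Rightarrow> 'a set \<Rightarrow> 'a set \<Rightarrow> bool" where
  "poincare_pair \<Omega> A B \<longleftrightarrow>
     (\<exists>K<top. \<forall>u e. energy_density \<Omega> u e \<longrightarrow> difference_integral u A B \<le> K * (\<integral>\<^sup>+z\<in>\<Omega>. e z \<partial>lborel))"

lemma difference_integral_mono:
  assumes "A' \<subseteq> A" "B' \<subseteq> B"
  shows "difference_integral u A' B' \<le> difference_integral u A B"
  unfolding difference_integral_def
  using assms by (intro nn_integral_mono mult_mono) (auto simp: indicator_def intro!: nn_integral_mono)

lemma poincare_pair_mono:
  assumes "poincare_pair \<Omega> A B" "A' \<subseteq> A" "B' \<subseteq> B"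
  shows "poincare_pair \<Omega> A' B'"
  using assms(1) difference_integral_mono[OF assms(2,3)] unfolding poincare_pair_def by (meson order_trans)

lemma poincare_pair_convex:
  fixes D :: "'a::euclidean_space set"
  assumes "convex D" "bounded D" "D \<in> sets borel" "D \<subseteq> \<Omega>"
  shows "poincare_pair \<Omega> D D"
proof -
  let ?K = "ennreal ((diameter D)\<^sup>2) * (2 ^ DIM('a) * emeasure lborel D)"
  have "difference_integral u D D \<le> ?K * (\<integral>\<^sup>+z\<in>\<Omega>. e z \<partial>lborel)" if "energy_density \<Omega> u e" for u e
  proof -
    have "difference_integral u D D
      \<le> ennreal ((diameter D)\<^sup>2) * (2 ^ DIM('a) * (\<integral>\<^sup>+z\<in>D. e z \<partial>lborel) * emeasure lborel D)"
      using assms that diameter_bounded_bound[OF \<open>bounded D\<close>] by (intro difference_integral_convex) auto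
    also have "\<dots> = ?K * (\<integral>\<^sup>+z\<in>D. e z \<partial>lborel)"
      by (simp add: ac_simps)
    also have "\<dots> \<le> ?K * (\<integral>\<^sup>+z\<in>\<Omega>. e z \<partial>lborel)"
      using \<open>D \<subseteq> \<Omega>\<close> by (intro mult_left_mono nn_integral_mono) (auto simp: indicator_def)
    finally show ?thesis .
  qed
  moreover have "?K < top"
    using emeasure_bounded_finite[OF \<open>bounded D\<close>] by (simp add: ennreal_mult_less_top power_less_top_ennreal)
  ultimately show ?thesis unfolding poincare_pair_def by blast
qed

lemma ennreal_le_mult_inverse:
  fixes a b c :: ennreal
  assumes "a * b \<le> c" "0 < b" "b < top"
  shows "a \<le> c * inverse b"
proof -
  have "a = a * (b * inverse b)"
    using assms(2,3) ennreal_divide_self[of b] by (simp add: divide_ennreal_def)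
  also have "\<dots> \<le> c * inverse b"
    using mult_right_mono[OF assms(1)] by (simp add: mult.assoc)
  finally show ?thesis .
qed

text \<open>
  \<open>(u x - u z)\<^sup>2 \<le> 2 (u x - u y)\<^sup>2 + 2 (u z - u y)\<^sup>2\<close>, integrated over \<open>x\<close>, \<open>y\<close> and \<open>z\<close>.
\<close>

lemma difference_integral_triangle:
  assumes [measurable]: "u \<in> borel_measurable borel" "A \<in> sets borel" "B \<in> sets borel" "C \<in> sets borel"
  shows "difference_integral u A C * emeasure lborel B
    \<le> 2 * emeasure lborel C * difference_integral u A B + 2 * emeasure lborel A * difference_integral u C B"
proof -
  let ?g = "\<lambda>x y. ennreal ((u x - u y)\<^sup>2)"
  have tri: "?g x z \<le> 2 * ?g x y + 2 * ?g z y" for x y z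
  proof -
    have "(u x - u z)\<^sup>2 \<le> 2 * (u x - u y)\<^sup>2 + 2 * (u z - u y)\<^sup>2"
      using sum_squares_bound[of "u x - u y" "u y - u z"] by (simp add: power2_eq_square algebra_simps)
    then show ?thesis
      by (simp add: ennreal_plus[symmetric] ennreal_mult'[symmetric] ennreal_numeral[symmetric] del: ennreal_plus ennreal_numeral)
  qed
  have pt: "?g x z * emeasure lborel B
      \<le> 2 * (\<integral>\<^sup>+y\<in>B. ?g x y \<partial>lborel) + 2 * (\<integral>\<^sup>+y\<in>B. ?g z y \<partial>lborel)" for x z
  proof -
    have "?g x z * emeasure lborel B = (\<integral>\<^sup>+y\<in>B. ?g x z \<partial>lborel)"
      by (simp add: nn_integral_cmult_indicator)
    also have "\<dots> \<le> (\<integral>\<^sup>+y. 2 * (?g x y * indicator B y) + 2 * (?g z y * indicator B y) \<partial>lborel)"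
      using tri by (intro nn_integral_mono) (auto simp: indicator_def)
    finally show ?thesis by (simp add: nn_integral_add nn_integral_cmult)
  qed
  have "difference_integral u A C * emeasure lborel B
     = (\<integral>\<^sup>+x\<in>A. (\<integral>\<^sup>+z\<in>C. ?g x z * emeasure lborel B \<partial>lborel) \<partial>lborel)"
  proof -
    have "(\<integral>\<^sup>+z\<in>C. ?g x z * emeasure lborel B \<partial>lborel) = (\<integral>\<^sup>+z\<in>C. ?g x z \<partial>lborel) * emeasure lborel B" for x
      by (subst nn_integral_multc[symmetric]) (auto simp: ac_simps)
    then show ?thesis
      unfolding difference_integral_def by (subst nn_integral_multc[symmetric]) (auto simp: ac_simps)
  qed
  also have "\<dots> \<le> (\<integral>\<^sup>+x\<in>A. (\<integral>\<^sup>+z\<in>C. 2 * (\<integral>\<^sup>+y\<in>B. ?g x y \<partial>lborel) + 2 * (\<integral>\<^sup>+y\<in>B. ?g z y \<partial>lborel) \<partial>lborel) \<partial>lborel)"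
    using pt by (intro nn_integral_mono mult_right_mono) auto
  also have "\<dots> = (\<integral>\<^sup>+x\<in>A. 2 * emeasure lborel C * (\<integral>\<^sup>+y\<in>B. ?g x y \<partial>lborel) + 2 * difference_integral u C B \<partial>lborel)"
  proof -
    have "(\<integral>\<^sup>+z\<in>C. 2 * a + 2 * (\<integral>\<^sup>+y\<in>B. ?g z y \<partial>lborel) \<partial>lborel)
      = 2 * emeasure lborel C * a + 2 * difference_integral u C B" for a
    proof -
      have "(\<integral>\<^sup>+z\<in>C. 2 * a + 2 * (\<integral>\<^sup>+y\<in>B. ?g z y \<partial>lborel) \<partial>lborel)
        = (\<integral>\<^sup>+z\<in>C. 2 * a \<partial>lborel) + (\<integral>\<^sup>+z. 2 * ((\<integral>\<^sup>+y\<in>B. ?g z y \<partial>lborel) * indicator C z) \<partial>lborel)"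
        by (subst nn_integral_add[symmetric]) (auto simp: distrib_right mult.assoc)
      also have "(\<integral>\<^sup>+z\<in>C. 2 * a \<partial>lborel) = 2 * emeasure lborel C * a"
        by (subst nn_integral_cmult_indicator) (auto simp: ac_simps)
      also have "(\<integral>\<^sup>+z. 2 * ((\<integral>\<^sup>+y\<in>B. ?g z y \<partial>lborel) * indicator C z) \<partial>lborel) = 2 * difference_integral u C B"
        unfolding difference_integral_def by (rule nn_integral_cmult) simp
      finally show ?thesis .
    qed
    then show ?thesis by simp
  qed
  also have "\<dots> = 2 * emeasure lborel C * difference_integral u A B + 2 * emeasure lborel A * difference_integral u C B"
  proof -
    have "(\<integral>\<^sup>+x\<in>A. 2 * difference_integral u C B \<partial>lborel) = 2 * emeasure lborel A * difference_integral u C B"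
      by (subst nn_integral_cmult_indicator) (auto simp: ac_simps)
    moreover have "(\<integral>\<^sup>+x\<in>A. 2 * emeasure lborel C * (\<integral>\<^sup>+y\<in>B. ?g x y \<partial>lborel) \<partial>lborel)
      = 2 * emeasure lborel C * difference_integral u A B"
      unfolding difference_integral_def by (subst nn_integral_cmult[symmetric]) (auto simp: mult.assoc)
    ultimately show ?thesis
      by (subst distrib_right, subst nn_integral_add) simp_all
  qed
  finally show ?thesis .
qed

text \<open>
  The intermediate set \<open>B\<close> must have positive measure, since the triangle inequality is averaged
  over it.
\<close>

lemma poincare_pair_trans:
  fixes A B C :: "'a::euclidean_space set"
  assumes AB: "poincare_pair \<Omega> A B" and CB: "poincare_pair \<Omega> C B"
    and m: "A \<in> sets borel" "B \<in> sets borel" "C \<in> sets borel"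
    and fin: "bounded A" "bounded B" "bounded C" and pos: "0 < emeasure lborel B"
  shows "poincare_pair \<Omega> A C"
proof -
  obtain K L where K: "K < top" "\<And>u e. energy_density \<Omega> u e \<Longrightarrow> difference_integral u A B \<le> K * (\<integral>\<^sup>+z\<in>\<Omega>. e z \<partial>lborel)"
    and L: "L < top" "\<And>u e. energy_density \<Omega> u e \<Longrightarrow> difference_integral u C B \<le> L * (\<integral>\<^sup>+z\<in>\<Omega>. e z \<partial>lborel)"
    using AB CB unfolding poincare_pair_def by blast
  let ?M = "(2 * emeasure lborel C * K + 2 * emeasure lborel A * L) * inverse (emeasure lborel B)"
  have "difference_integral u A C \<le> ?M * (\<integral>\<^sup>+z\<in>\<Omega>. e z \<partial>lborel)" if ed: "energy_density \<Omega> u e" for u e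
  proof -
    have "u \<in> borel_measurable borel" using ed by (simp add: energy_density_def)
    then have "difference_integral u A C * emeasure lborel B
      \<le> 2 * emeasure lborel C * difference_integral u A B + 2 * emeasure lborel A * difference_integral u C B"
      using m by (rule difference_integral_triangle)
    also have "\<dots> \<le> 2 * emeasure lborel C * (K * (\<integral>\<^sup>+z\<in>\<Omega>. e z \<partial>lborel)) + 2 * emeasure lborel A * (L * (\<integral>\<^sup>+z\<in>\<Omega>. e z \<partial>lborel))"
      using K(2)[OF ed] L(2)[OF ed] by (intro add_mono mult_left_mono) auto
    finally have le: "difference_integral u A C * emeasure lborel B
      \<le> 2 * emeasure lborel C * (K * (\<integral>\<^sup>+z\<in>\<Omega>. e z \<partial>lborel)) + 2 * emeasure lborel A * (L * (\<integral>\<^sup>+z\<in>\<Omega>. e z \<partial>lborel))" .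
    have "difference_integral u A C \<le> (2 * emeasure lborel C * (K * (\<integral>\<^sup>+z\<in>\<Omega>. e z \<partial>lborel)) + 2 * emeasure lborel A * (L * (\<integral>\<^sup>+z\<in>\<Omega>. e z \<partial>lborel))) * inverse (emeasure lborel B)"
      by (rule ennreal_le_mult_inverse[OF le pos]) (use emeasure_bounded_finite[OF fin(2)] in simp)
    then show ?thesis by (simp add: algebra_simps)
  qed
  moreover have "?M < top"
  proof -
    have "emeasure lborel A < top" "emeasure lborel C < top" "inverse (emeasure lborel B) < top"
      using emeasure_bounded_finite[OF fin(1)] emeasure_bounded_finite[OF fin(3)] pos by (auto simp: less_top[symmetric])
    then show ?thesis using K(1) L(1) by (simp add: ennreal_mult_less_top)
  qed
  ultimately show ?thesis unfolding poincare_pair_def by blast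
qed

lemma emeasure_lborel_open_pos:
  fixes S :: "'a::euclidean_space set"
  assumes "open S" "S \<noteq> {}"
  shows "0 < emeasure lborel S"
proof -
  have "S \<notin> null_sets lborel"
    using open_not_negligible[OF assms] null_sets_completionI by (auto simp: negligible_iff_null_sets)
  then show ?thesis using \<open>open S\<close> by (auto simp: null_sets_def zero_less_iff_neq_zero)
qed

lemma poincare_pair_via_overlap:
  assumes AB: "poincare_pair \<Omega> A B" and B: "open B" "bounded B" and A: "A \<in> sets borel" "bounded A"
    and D: "open D" "convex D" "bounded D" "D \<subseteq> \<Omega>" and ne: "B \<inter> D \<noteq> {}"
  shows "poincare_pair \<Omega> A D"
proof (rule poincare_pair_trans)
  show "poincare_pair \<Omega> A (B \<inter> D)" using AB by (rule poincare_pair_mono) auto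
  show "poincare_pair \<Omega> D (B \<inter> D)"
    by (rule poincare_pair_mono[OF poincare_pair_convex[of D]]) (use D in auto)
  show "0 < emeasure lborel (B \<inter> D)"
    using ne B D by (intro emeasure_lborel_open_pos) auto
qed (use assms in auto)

text \<open>
  The property propagates through each ball \<open>U\<close> contained in \<open>\<Omega>\<close>: if it holds at one point of \<open>U\<close>,
  then \<open>U\<close> overlaps a ball that is related to the fixed one, so \<open>U\<close> and all smaller balls in it are
  related to the fixed one as well.
\<close>

lemma poincare_pair_balls:
  fixes \<Omega> :: "'a::euclidean_space set"
  assumes \<Omega>: "open \<Omega>" "connected \<Omega>" and B: "ball a r \<subseteq> \<Omega>" "r > 0" and "x \<in> \<Omega>"
  shows "\<exists>s>0. ball x s \<subseteq> \<Omega> \<and> poincare_pair \<Omega> (ball a r) (ball x s)"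
proof -
  define Q where "Q x \<longleftrightarrow> (\<exists>s>0. ball x s \<subseteq> \<Omega> \<and> poincare_pair \<Omega> (ball a r) (ball x s))" for x
  have "a \<in> \<Omega>" using B centre_in_ball by blast
  have "Q a" unfolding Q_def using B by (intro exI[of _ r]) (simp add: poincare_pair_convex)
  have "Q x"
  proof (rule connected_induction_simple[of \<Omega> a x Q])
    fix y assume "y \<in> \<Omega>"
    with \<open>open \<Omega>\<close> obtain s where s: "s > 0" "ball y s \<subseteq> \<Omega>" by (rule openE)
    have "Q w" if "z \<in> ball y s" "w \<in> ball y s" "Q z" for z w
    proof -
      obtain s' where s': "s' > 0" "poincare_pair \<Omega> (ball a r) (ball z s')"
        using \<open>Q z\<close> unfolding Q_def by metis
      have "z \<in> ball z s'" using s' by simp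
      then have "ball z s' \<inter> ball y s \<noteq> {}" using \<open>z \<in> ball y s\<close> by (metis IntI empty_iff)
      then have "poincare_pair \<Omega> (ball a r) (ball y s)"
        using s by (intro poincare_pair_via_overlap[OF s'(2)]) simp_all
      moreover obtain t where "t > 0" "ball w t \<subseteq> ball y s"
        by (rule openE[OF open_ball \<open>w \<in> ball y s\<close>])
      ultimately show ?thesis
        unfolding Q_def using s poincare_pair_mono[OF _ order_refl, of \<Omega> "ball a r" "ball y s" "ball w t"]
        by (intro exI[of _ t]) simp_all
    qed
    moreover have "openin (top_of_set \<Omega>) (ball y s)" "y \<in> ball y s"
      using s \<open>open \<Omega>\<close> by (simp_all add: openin_open_eq)
    ultimately show "\<exists>T. openin (top_of_set \<Omega>) T \<and> y \<in> T \<and> (\<forall>x\<in>T. \<forall>y\<in>T. Q x \<longrightarrow> Q y)"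
      by blast
  qed (rule \<open>connected \<Omega>\<close> \<open>a \<in> \<Omega>\<close> \<open>x \<in> \<Omega>\<close> \<open>Q a\<close>)+
  then show ?thesis by (simp add: Q_def)
qed

lemma poincare_pair_Un:
  assumes "poincare_pair \<Omega> A B" "poincare_pair \<Omega> A C" and [measurable]: "A \<in> sets borel" "B \<in> sets borel" "C \<in> sets borel"
  shows "poincare_pair \<Omega> A (B \<union> C)"
proof -
  obtain K L where K: "K < top" "\<And>u e. energy_density \<Omega> u e \<Longrightarrow> difference_integral u A B \<le> K * (\<integral>\<^sup>+z\<in>\<Omega>. e z \<partial>lborel)"
    and L: "L < top" "\<And>u e. energy_density \<Omega> u e \<Longrightarrow> difference_integral u A C \<le> L * (\<integral>\<^sup>+z\<in>\<Omega>. e z \<partial>lborel)"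
    using assms(1,2) unfolding poincare_pair_def by blast
  have "difference_integral u A (B \<union> C) \<le> (K + L) * (\<integral>\<^sup>+z\<in>\<Omega>. e z \<partial>lborel)" if ed: "energy_density \<Omega> u e" for u e
  proof -
    have [measurable]: "u \<in> borel_measurable borel" using ed by (simp add: energy_density_def)
    have "difference_integral u A (B \<union> C) \<le> (\<integral>\<^sup>+x. (\<integral>\<^sup>+y\<in>B. ennreal ((u x - u y)\<^sup>2) \<partial>lborel) * indicator A x
        + (\<integral>\<^sup>+y\<in>C. ennreal ((u x - u y)\<^sup>2) \<partial>lborel) * indicator A x \<partial>lborel)"
      unfolding difference_integral_def
      by (intro nn_integral_mono)
         (auto simp: nn_integral_add[symmetric] distrib_right[symmetric] indicator_def intro!: mult_right_mono nn_integral_mono)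
    also have "\<dots> = difference_integral u A B + difference_integral u A C"
      unfolding difference_integral_def by (rule nn_integral_add) auto
    also have "\<dots> \<le> (K + L) * (\<integral>\<^sup>+z\<in>\<Omega>. e z \<partial>lborel)"
      using K(2)[OF ed] L(2)[OF ed] by (auto simp: distrib_right intro: add_mono)
    finally show ?thesis .
  qed
  then show ?thesis unfolding poincare_pair_def using K(1) L(1) by (metis ennreal_add_less_top)
qed

text \<open>
  Once a fixed ball \<open>B\<close> is related to each member of the cover, it is related to \<open>\<Omega>\<close>.
  The constant \<open>c\<close> can then be taken to be a value \<open>u y\<close> with \<open>y \<in> B\<close>: not all of these can do
  worse than the average over \<open>B\<close>.
\<close>

theorem poincare_inequality:
  fixes \<Omega> :: "'a::euclidean_space set"
  assumes \<Omega>: "open \<Omega>" "connected \<Omega>" "\<Omega> \<noteq> {}"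
    and \<D>: "finite \<D>" "\<And>D. D \<in> \<D> \<Longrightarrow> open D \<and> convex D \<and> bounded D \<and> D \<noteq> {} \<and> D \<subseteq> \<Omega>"
    and cover: "negligible (\<Omega> - \<Union>\<D>)"
  shows "\<exists>K>0. \<forall>u e. energy_density \<Omega> u e \<longrightarrow>
    (\<exists>c. (\<integral>\<^sup>+x\<in>\<Omega>. ennreal ((u x - c)\<^sup>2) \<partial>lborel) \<le> ennreal K * (\<integral>\<^sup>+x\<in>\<Omega>. e x \<partial>lborel))"
proof -
  obtain a where "a \<in> \<Omega>" using \<Omega>(3) by blast
  obtain r where r: "r > 0" and ar: "ball a r \<subseteq> \<Omega>"
    by (rule openE[OF \<Omega>(1) \<open>a \<in> \<Omega>\<close>])
  let ?B = "ball a r"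
  have pD: "poincare_pair \<Omega> ?B D" if "D \<in> \<D>" for D
  proof -
    obtain x where x: "x \<in> D" "x \<in> \<Omega>" using \<D>(2) \<open>D \<in> \<D>\<close> by blast
    obtain s where "s > 0" and s: "poincare_pair \<Omega> ?B (ball x s)"
      using poincare_pair_balls[OF \<Omega>(1,2) ar r x(2)] by blast
    have ne: "ball x s \<inter> D \<noteq> {}" using x \<open>s > 0\<close> centre_in_ball by blast
    show ?thesis
      by (rule poincare_pair_via_overlap[OF s _ _ _ _ _ _ _ _ ne]) (use \<D>(2)[OF \<open>D \<in> \<D>\<close>] in simp_all)
  qed
  have "\<D>' \<subseteq> \<D> \<Longrightarrow> poincare_pair \<Omega> ?B (\<Union>\<D>')" if "finite \<D>'" for \<D>'
    using that
  proof induction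
    case empty
    show ?case unfolding poincare_pair_def difference_integral_def by (intro exI[of _ 0]) simp
  next
    case (insert D \<D>')
    have "open (\<Union>\<D>')" by (rule open_Union) (use insert.prems \<D>(2) in blast)
    moreover have "open D" "poincare_pair \<Omega> ?B D" using insert.prems \<D>(2) pD by blast+
    moreover have "poincare_pair \<Omega> ?B (\<Union>\<D>')" using insert.IH insert.prems by simp
    ultimately show ?case using poincare_pair_Un[of \<Omega> ?B D "\<Union>\<D>'"] by simp
  qed
  then have "poincare_pair \<Omega> ?B (\<Union>\<D>)" using \<D>(1) by simp
  then obtain K where K: "K < top"
    "\<And>u e. energy_density \<Omega> u e \<Longrightarrow> difference_integral u ?B (\<Union>\<D>) \<le> K * (\<integral>\<^sup>+z\<in>\<Omega>. e z \<partial>lborel)"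
    unfolding poincare_pair_def by blast
  have Bpos: "0 < emeasure lborel ?B" using r by (intro emeasure_lborel_open_pos) auto
  have Bfin: "emeasure lborel ?B < top" using emeasure_bounded_finite[of ?B] by simp
  have sub: "\<Union>\<D> \<subseteq> \<Omega>" using \<D>(2) by blast
  \<comment> \<open>\<open>K + 1\<close> instead of \<open>K\<close> makes the constant positive.\<close>
  define L where "L = (K + 1) * inverse (emeasure lborel ?B)"
  have L: "L < top" "L > 0"
  proof -
    have "inverse (emeasure lborel ?B) < top" "0 < inverse (emeasure lborel ?B)" "0 < K + 1"
      using Bpos Bfin by (auto simp: less_top[symmetric] ennreal_inverse_positive add_nonneg_pos)
    then show "L < top" "L > 0"
      using K(1) by (auto simp: L_def ennreal_mult_less_top ennreal_zero_less_mult_iff)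
  qed
  have AE: "AE x in lborel. x \<in> \<Omega> \<longrightarrow> x \<in> \<Union>\<D>"
  proof -
    have "open (\<Union>\<D>)" by (rule open_Union) (use \<D>(2) in blast)
    then have "\<Omega> - \<Union>\<D> \<in> sets borel" using \<Omega>(1) by (intro sets.Diff borel_open)
    then have "\<Omega> - \<Union>\<D> \<in> null_sets lborel"
      using cover by (simp add: negligible_iff_null_sets null_sets_completion_iff)
    then show ?thesis using AE_not_in[of "\<Omega> - \<Union>\<D>" lborel] by simp
  qed
  have main: "\<exists>c. (\<integral>\<^sup>+x\<in>\<Omega>. ennreal ((u x - c)\<^sup>2) \<partial>lborel) \<le> L * (\<integral>\<^sup>+x\<in>\<Omega>. e x \<partial>lborel)" (is "\<exists>c. ?I c \<le> L * ?E")
    if ed: "energy_density \<Omega> u e" for u e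
  proof (rule ccontr)
    assume "\<not> ?thesis"
    then have gt: "L * ?E < ?I c" for c by (simp add: not_le)
    have [measurable]: "u \<in> borel_measurable borel" "\<Omega> \<in> sets borel" "?B \<in> sets borel" using ed \<Omega> by (auto simp: energy_density_def)
    have fin: "L * ?E * emeasure lborel ?B < top"
      using less_le_trans[OF gt[of 0] top_greatest] Bfin by (simp add: ennreal_mult_less_top)
    have "(\<integral>\<^sup>+y\<in>?B. L * ?E \<partial>lborel) < (\<integral>\<^sup>+y\<in>?B. ?I (u y) \<partial>lborel)"
    proof (rule nn_integral_less)
      show "(\<integral>\<^sup>+y\<in>?B. L * ?E \<partial>lborel) \<noteq> \<infinity>"
        using fin by (simp add: nn_integral_cmult_indicator)
      show "AE y in lborel. L * ?E * indicator ?B y \<le> ?I (u y) * indicator ?B y"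
        using gt by (intro AE_I2 mult_right_mono) (auto simp: less_imp_le)
      show "\<not> (AE y in lborel. ?I (u y) * indicator ?B y \<le> L * ?E * indicator ?B y)"
      proof
        assume "AE y in lborel. ?I (u y) * indicator ?B y \<le> L * ?E * indicator ?B y"
        then have "AE y in lborel. y \<notin> ?B"
        proof (rule eventually_mono)
          fix y assume "?I (u y) * indicator ?B y \<le> L * ?E * indicator ?B y"
          then show "y \<notin> ?B" using gt[of "u y"] by (cases "y \<in> ?B") (simp_all add: not_le[symmetric])
        qed
        then have "emeasure lborel ?B = 0"
          by (subst (asm) AE_iff_null_sets[symmetric]) (simp_all add: null_sets_def)
        then show False using Bpos by simp
      qed
    qed measurable
    also have "(\<integral>\<^sup>+y\<in>?B. ?I (u y) \<partial>lborel) = difference_integral u ?B (\<Union>\<D>)"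
    proof -
      have "AE x in lborel. ennreal ((u x - u y)\<^sup>2) * indicator \<Omega> x = ennreal ((u y - u x)\<^sup>2) * indicator (\<Union>\<D>) x" for y
        using AE by (rule eventually_mono) (use sub in \<open>auto simp: indicator_def power2_commute\<close>)
      then have "?I (u y) = (\<integral>\<^sup>+x\<in>\<Union>\<D>. ennreal ((u y - u x)\<^sup>2) \<partial>lborel)" for y
        by (intro nn_integral_cong_AE)
      then show ?thesis by (simp add: difference_integral_def)
    qed
    also have "\<dots> \<le> (K + 1) * ?E"
      using K(2)[OF ed] by (rule order_trans) (intro mult_right_mono, auto)
    also have "\<dots> = L * ?E * emeasure lborel ?B"
    proof -
      have "inverse (emeasure lborel ?B) * emeasure lborel ?B = 1"
        using Bpos Bfin using ennreal_divide_self[of "emeasure lborel ?B"] by (simp add: divide_ennreal_def mult.commute)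
      moreover have "L * ?E * emeasure lborel ?B
        = (K + 1) * ?E * (inverse (emeasure lborel ?B) * emeasure lborel ?B)"
        unfolding L_def by (simp only: ac_simps)
      ultimately show ?thesis by simp
    qed
    also have "\<dots> = (\<integral>\<^sup>+y\<in>?B. L * ?E \<partial>lborel)"
      by (rule nn_integral_cmult_indicator[symmetric]) simp
    finally show False by (rule less_irrefl[THEN notE])
  qed
  have "ennreal (enn2real L) = L" "0 < enn2real L"
    using L by (simp_all add: enn2real_positive_iff)
  then show ?thesis
    using main by (intro exI[of _ "enn2real L"]) (simp only: simp_thms, blast)
qed

section \<open>Piecewise Lipschitz functions\<close>

text \<open>
  The Cauchy-Schwarz inequality for the vectors \<open>(sqrt p, sqrt q)\<close> and \<open>(sqrt A, sqrt B)\<close>.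
\<close>

lemma sum_squares_le_product:
  fixes x y p q A B :: real
  assumes "x\<^sup>2 \<le> p * A" "y\<^sup>2 \<le> q * B" "0 \<le> p" "0 \<le> q" "0 \<le> A" "0 \<le> B"
  shows "(x + y)\<^sup>2 \<le> (p + q) * (A + B)"
proof -
  have "(2 * (x * y))\<^sup>2 = 4 * (x\<^sup>2 * y\<^sup>2)" by (simp add: power_mult_distrib)
  also have "\<dots> \<le> 4 * ((p * A) * (q * B))" using assms by (intro mult_left_mono mult_mono) auto
  also have "\<dots> \<le> (p * B + q * A)\<^sup>2"
    using sum_squares_bound[of "p * B" "q * A"] by (simp add: power2_eq_square algebra_simps)
  finally have "2 * (x * y) \<le> p * B + q * A"
    by (rule power2_le_imp_le) (simp add: assms)
  moreover have "(x + y)\<^sup>2 = x\<^sup>2 + y\<^sup>2 + 2 * (x * y)" by (simp add: power2_sum)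
  moreover have "(p + q) * (A + B) = p * A + q * B + (p * B + q * A)" by (simp add: algebra_simps)
  ultimately show ?thesis using assms(1,2) by linarith
qed

text \<open>
  The right-hand side bounds the length of the interval times the integral of \<open>\<bar>f'\<bar>\<^sup>2\<close>.  The
  induction removes a piece \<open>I k\<close> that contains the left end of the interval, together with the
  part of the interval up to the last point of \<open>I k\<close>; the other pieces cover the rest.
\<close>

lemma piecewise_lipschitz_interval:
  fixes f :: "real \<Rightarrow> real" and L :: "'k \<Rightarrow> real"
  assumes "finite K" "a \<le> b" "{a..b} \<subseteq> (\<Union>k\<in>K. I k)"
    and "\<And>k. k \<in> K \<Longrightarrow> closed (I k) \<and> convex (I k)"
    and "\<And>k s t. k \<in> K \<Longrightarrow> s \<in> I k \<Longrightarrow> t \<in> I k \<Longrightarrow> \<bar>f s - f t\<bar> \<le> L k * \<bar>s - t\<bar>"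
  shows "(f b - f a)\<^sup>2 \<le> (b - a) * (\<Sum>k\<in>K. (L k)\<^sup>2 * measure lborel (I k \<inter> {a..b}))"
  using assms
proof (induction "card K" arbitrary: K a)
  case 0
  have "K = {}" using card_0_eq[OF 0(2)] 0(1) by simp
  then show ?case using 0(3,4) by simp
next
  case (Suc n)
  note closed = Suc.prems(4) and lip = Suc.prems(5)
  obtain k where k: "k \<in> K" "a \<in> I k"
  proof -
    have "a \<in> {a..b}" using Suc.prems(2) by simp
    then show ?thesis using Suc.prems(3) that by blast
  qed
  let ?J = "I k \<inter> {a..b}" and ?K = "K - {k}"
  define c where "c = Sup ?J"
  have bdd: "bdd_above ?J" by (rule bdd_above_mono[of "{a..b}"]) auto
  have cJ: "c \<in> ?J"
    unfolding c_def using k Suc.prems(2) closed[OF k(1)] bdd by (intro closed_contains_Sup) auto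
  then have c: "a \<le> c" "c \<le> b" "c \<in> I k" by auto
  have upper: "t \<le> c" if "t \<in> ?J" for t unfolding c_def using that bdd by (rule cSup_upper)
  have ac: "{a..c} \<subseteq> I k"
    using closed_segment_subset[of a "I k" c] closed[OF k(1)] k(2) c(3) c(1) by (simp add: closed_segment_eq_real_ivl)
  have "\<bar>f c - f a\<bar> \<le> L k * (c - a)" using lip[OF k(1) c(3) k(2)] c by simp
  then have "(f c - f a)\<^sup>2 \<le> (L k * (c - a))\<^sup>2" using power_mono[of "\<bar>f c - f a\<bar>" _ 2] by simp
  then have left: "(f c - f a)\<^sup>2 \<le> (c - a) * ((L k)\<^sup>2 * (c - a))" by (simp add: power2_eq_square mult_ac)
  have right: "(f b - f c)\<^sup>2 \<le> (b - c) * (\<Sum>j\<in>?K. (L j)\<^sup>2 * measure lborel (I j \<inter> {c..b}))"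
  proof (cases "c = b")
    case False
    show ?thesis
    proof (rule Suc.hyps(1))
      show "n = card ?K" using Suc.hyps(2) k by simp
      have "{c<..b} \<subseteq> (\<Union>j\<in>?K. I j)"
      proof
        fix t assume t: "t \<in> {c<..b}"
        then have "t \<notin> I k" using upper[of t] c by auto
        moreover have "t \<in> {a..b}" using t c by simp
        ultimately show "t \<in> (\<Union>j\<in>?K. I j)" using Suc.prems(3) by blast
      qed
      moreover have "closed (\<Union>j\<in>?K. I j)" using Suc.prems(1) closed by (intro closed_UN) auto
      ultimately have "closure {c<..b} \<subseteq> (\<Union>j\<in>?K. I j)" by (rule closure_minimal)
      then show "{c..b} \<subseteq> (\<Union>j\<in>?K. I j)" using False c by simp
      show "c \<le> b" by (rule c)
      show "finite ?K" using Suc.prems(1) by simp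
      show "closed (I j) \<and> convex (I j)" if "j \<in> ?K" for j using closed that by simp
      show "\<bar>f s - f t\<bar> \<le> L j * \<bar>s - t\<bar>" if "j \<in> ?K" "s \<in> I j" "t \<in> I j" for j s t
        using lip[of j s t] that by simp
    qed
  qed simp
  let ?S = "\<Sum>j\<in>?K. (L j)\<^sup>2 * measure lborel (I j \<inter> {c..b})"
  have fin: "emeasure lborel (I j \<inter> {a..b}) \<noteq> \<infinity>" for j
    using emeasure_bounded_finite[of "I j \<inter> {a..b}"] by (simp add: bounded_Int)
  have meas: "I j \<inter> {a..b} \<in> sets lborel" if "j \<in> K" for j using closed[OF that] by auto
  have "(f b - f a)\<^sup>2 = ((f c - f a) + (f b - f c))\<^sup>2" by simp
  also have "\<dots> \<le> ((c - a) + (b - c)) * ((L k)\<^sup>2 * (c - a) + ?S)"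
    using left right c by (intro sum_squares_le_product) (auto intro!: sum_nonneg)
  also have "\<dots> \<le> (b - a) * (\<Sum>j\<in>K. (L j)\<^sup>2 * measure lborel (I j \<inter> {a..b}))"
  proof -
    have "c - a = measure lborel {a..c}" using c by simp
    also have "\<dots> \<le> measure lborel ?J"
      using ac c fin[of k] meas[OF k(1)] by (intro measure_mono_fmeasurable) (auto simp: fmeasurable_def less_top)
    finally have 1: "(L k)\<^sup>2 * (c - a) \<le> (L k)\<^sup>2 * measure lborel ?J" by (simp add: mult_left_mono)
    have "measure lborel (I j \<inter> {c..b}) \<le> measure lborel (I j \<inter> {a..b})" if "j \<in> K" for j
      using c fin[of j] meas[OF that] closed[OF that]
      by (intro measure_mono_fmeasurable) (auto simp: fmeasurable_def less_top)
    then have 2: "?S \<le> (\<Sum>j\<in>?K. (L j)\<^sup>2 * measure lborel (I j \<inter> {a..b}))"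
      by (intro sum_mono mult_left_mono) auto
    have "(L k)\<^sup>2 * (c - a) + ?S \<le> (\<Sum>j\<in>K. (L j)\<^sup>2 * measure lborel (I j \<inter> {a..b}))"
      using 1 2 k Suc.prems(1) by (subst sum.remove[of K k]) auto
    then show ?thesis using Suc.prems(2) by (simp add: mult_left_mono)
  qed
  finally show ?case .
qed

text \<open>
  The parameters at which a segment lies in a convex piece form an interval, so the bound on an
  interval applies to the restriction of \<open>u\<close> to the segment.  Pieces may overlap; the density
  is then a sum of several terms.
\<close>

lemma energy_density_piecewise_lipschitz:
  fixes u :: "'a::euclidean_space \<Rightarrow> real"
  assumes u: "u \<in> borel_measurable borel" and fin: "finite \<S>"
    and S: "\<And>S. S \<in> \<S> \<Longrightarrow> closed S \<and> convex S"
    and lip: "\<And>S x y. S \<in> \<S> \<Longrightarrow> x \<in> S \<Longrightarrow> y \<in> S \<Longrightarrow> \<bar>u x - u y\<bar> \<le> L S * dist x y"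
    and cover: "\<Omega> \<subseteq> \<Union>\<S>"
  shows "energy_density \<Omega> u (\<lambda>z. \<Sum>S\<in>\<S>. ennreal ((L S)\<^sup>2) * indicator S z)"
  unfolding energy_density_def
proof (intro conjI allI impI)
  have Sb: "S \<in> sets borel" if "S \<in> \<S>" for S using S[OF that] by simp
  show "(\<lambda>z. \<Sum>S\<in>\<S>. ennreal ((L S)\<^sup>2) * indicator S z) \<in> borel_measurable borel"
    using Sb by (intro borel_measurable_sum borel_measurable_times) simp_all
  fix x y :: 'a assume seg: "closed_segment x y \<subseteq> \<Omega>"
  define \<gamma> where "\<gamma> t = (1 - t) *\<^sub>R x + t *\<^sub>R y" for t
  define I where "I S = \<gamma> -` S" for S
  have cont: "continuous_on UNIV \<gamma>" unfolding \<gamma>_def by (intro continuous_intros)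
  have dist: "dist (\<gamma> s) (\<gamma> t) = dist x y * \<bar>s - t\<bar>" for s t
  proof -
    have "\<gamma> s - \<gamma> t = (t - s) *\<^sub>R (x - y)" by (simp add: \<gamma>_def algebra_simps)
    then show ?thesis by (simp add: dist_norm abs_minus_commute)
  qed
  have "(u (\<gamma> 1) - u (\<gamma> 0))\<^sup>2
    \<le> (1 - 0) * (\<Sum>S\<in>\<S>. (L S * dist x y)\<^sup>2 * measure lborel (I S \<inter> {0..1}))"
  proof (rule piecewise_lipschitz_interval[where f = "\<lambda>t. u (\<gamma> t)"])
    show "{0..1} \<subseteq> (\<Union>S\<in>\<S>. I S)"
    proof
      fix t :: real assume "t \<in> {0..1}"
      then have "\<gamma> t \<in> closed_segment x y" by (auto simp: \<gamma>_def closed_segment_def)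
      then have "\<gamma> t \<in> \<Union>\<S>" using seg cover by blast
      then show "t \<in> (\<Union>S\<in>\<S>. I S)" by (simp add: I_def)
    qed
    show "closed (I S) \<and> convex (I S)" if "S \<in> \<S>" for S
    proof
      show "closed (I S)"
        unfolding I_def using S[OF that] cont by (intro continuous_closed_vimage) (simp_all add: continuous_on_eq_continuous_at)
      show "convex (I S)"
      proof (rule convexI)
        fix s t p q :: real assume st: "s \<in> I S" "t \<in> I S" and pq: "0 \<le> p" "0 \<le> q" "p + q = 1"
        have "\<gamma> (p *\<^sub>R s + q *\<^sub>R t) = ((p + q) - (p * s + q * t)) *\<^sub>R x + (p * s + q * t) *\<^sub>R y"
          using pq by (simp add: \<gamma>_def)
        also have "\<dots> = p *\<^sub>R \<gamma> s + q *\<^sub>R \<gamma> t"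
          by (simp add: \<gamma>_def algebra_simps)
        also have "\<dots> \<in> S" using S[OF that] st pq by (intro convexD) (simp_all add: I_def)
        finally show "p *\<^sub>R s + q *\<^sub>R t \<in> I S" by (simp add: I_def)
      qed
    qed
    show "\<bar>u (\<gamma> s) - u (\<gamma> t)\<bar> \<le> L S * dist x y * \<bar>s - t\<bar>" if "S \<in> \<S>" "s \<in> I S" "t \<in> I S" for S s t
      using lip[of S "\<gamma> s" "\<gamma> t"] that by (simp add: I_def dist mult.assoc)
  qed (use fin in simp_all)
  then have real_bound: "(u x - u y)\<^sup>2 \<le> (dist x y)\<^sup>2 * (\<Sum>S\<in>\<S>. (L S)\<^sup>2 * measure lborel (I S \<inter> {0..1}))"
    by (simp add: \<gamma>_def power2_commute[of "u x"] power_mult_distrib sum_distrib_left mult_ac)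
  have Ib: "I S \<inter> {0..1} \<in> sets borel" if "S \<in> \<S>" for S
  proof -
    have "closed (I S)"
      unfolding I_def using S[OF that] cont by (intro continuous_closed_vimage) (simp_all add: continuous_on_eq_continuous_at)
    then show ?thesis by simp
  qed
  have fin': "emeasure lborel (I S \<inter> {0..1}) = ennreal (measure lborel (I S \<inter> {0..1}))" for S
    using emeasure_bounded_finite[of "I S \<inter> {0..1}"] by (intro emeasure_eq_ennreal_measure) (simp add: bounded_Int less_top)
  have "(\<integral>\<^sup>+t\<in>{0..1}. (\<Sum>S\<in>\<S>. ennreal ((L S)\<^sup>2) * indicator S (\<gamma> t)) \<partial>lborel)
     = (\<integral>\<^sup>+t. (\<Sum>S\<in>\<S>. ennreal ((L S)\<^sup>2) * indicator (I S \<inter> {0..1}) t) \<partial>lborel)"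
    by (intro nn_integral_cong) (simp add: sum_distrib_right I_def indicator_inter_arith indicator_vimage mult.assoc)
  also have "\<dots> = (\<Sum>S\<in>\<S>. ennreal ((L S)\<^sup>2) * emeasure lborel (I S \<inter> {0..1}))"
    using Ib by (subst nn_integral_sum) (simp_all add: nn_integral_cmult_indicator cong: sum.cong)
  also have "\<dots> = ennreal (\<Sum>S\<in>\<S>. (L S)\<^sup>2 * measure lborel (I S \<inter> {0..1}))"
    by (subst sum_ennreal[symmetric]) (simp_all add: fin' ennreal_mult)
  finally have int: "(\<integral>\<^sup>+t\<in>{0..1}. (\<Sum>S\<in>\<S>. ennreal ((L S)\<^sup>2) * indicator S (\<gamma> t)) \<partial>lborel)
     = ennreal (\<Sum>S\<in>\<S>. (L S)\<^sup>2 * measure lborel (I S \<inter> {0..1}))" .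
  show "ennreal ((u x - u y)\<^sup>2) \<le> ennreal ((dist x y)\<^sup>2)
      * (\<integral>\<^sup>+t\<in>{0..1}. (\<Sum>S\<in>\<S>. ennreal ((L S)\<^sup>2) * indicator S ((1 - t) *\<^sub>R x + t *\<^sub>R y)) \<partial>lborel)"
    using real_bound int unfolding \<gamma>_def[symmetric] by (simp add: ennreal_mult'[symmetric] ennreal_leI)
qed (rule u)

section \<open>Affine functions on simplices\<close>

text \<open>
  For affine \<open>w\<close> one has \<open>w v = 2 w ((v + y) / 2) - w y\<close>, and the points \<open>(v + y) / 2\<close> with
  \<open>y \<in> S\<close> fill a copy of \<open>S\<close> that is contained in \<open>S\<close> and half as large.  The constant depends on
  the dimension only.
\<close>

lemma value_at_point_le_integral:
  fixes S :: "'a::euclidean_space set"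
  assumes "convex S" and [measurable]: "S \<in> sets borel" "w \<in> borel_measurable borel" and "v \<in> S"
    and mid: "\<And>y. y \<in> S \<Longrightarrow> w (midpoint v y) = (w v + w y) / 2"
  shows "emeasure lborel S * ennreal ((w v)\<^sup>2)
    \<le> (8 * 2 ^ DIM('a) + 2) * (\<integral>\<^sup>+y\<in>S. ennreal ((w y)\<^sup>2) \<partial>lborel)"
proof -
  let ?q = "\<lambda>y. ennreal ((w y)\<^sup>2)"
  have half: "(1 - 1/2) *\<^sub>R v + (1/2) *\<^sub>R y = midpoint v y" for y
    by (simp add: midpoint_def scaleR_add_right)
  have sq: "(2 * a - b)\<^sup>2 \<le> 8 * a\<^sup>2 + 2 * b\<^sup>2" for a b :: real
    using sum_squares_bound[of "- 2 * a" b] by (simp add: power2_eq_square algebra_simps)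
  have pt: "?q v \<le> 8 * ?q (midpoint v y) + 2 * ?q y" if "y \<in> S" for y
  proof -
    have "w v = 2 * w (midpoint v y) - w y" using mid[OF that] by simp
    then have "(w v)\<^sup>2 \<le> 8 * (w (midpoint v y))\<^sup>2 + 2 * (w y)\<^sup>2"
      using sq[of "w (midpoint v y)" "w y"] by simp
    then have "?q v \<le> ennreal (8 * (w (midpoint v y))\<^sup>2 + 2 * (w y)\<^sup>2)" by (rule ennreal_leI)
    also have "\<dots> = 8 * ?q (midpoint v y) + 2 * ?q y"
      by (simp add: ennreal_plus ennreal_mult)
    finally show ?thesis .
  qed
  have [measurable]: "(\<lambda>y. midpoint v y) \<in> borel_measurable borel"
    unfolding midpoint_def by measurable
  have "emeasure lborel S * ?q v = (\<integral>\<^sup>+y\<in>S. ?q v \<partial>lborel)"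
    by (subst nn_integral_cmult_indicator) (simp_all add: mult.commute)
  also have "\<dots> \<le> (\<integral>\<^sup>+y. 8 * (?q (midpoint v y) * indicator S y) + 2 * (?q y * indicator S y) \<partial>lborel)"
    using pt by (intro nn_integral_mono) (simp add: indicator_def)
  also have "\<dots> = 8 * (\<integral>\<^sup>+y\<in>S. ?q (midpoint v y) \<partial>lborel) + 2 * (\<integral>\<^sup>+y\<in>S. ?q y \<partial>lborel)"
    by (subst nn_integral_add) (simp_all add: nn_integral_cmult)
  also have "\<dots> \<le> 8 * (2 ^ DIM('a) * (\<integral>\<^sup>+y\<in>S. ?q y \<partial>lborel)) + 2 * (\<integral>\<^sup>+y\<in>S. ?q y \<partial>lborel)"
    using nn_integral_shrink_convex[of S ?q v "1/2"] assms(1,4)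
    by (intro add_mono mult_left_mono) (simp_all only: half, simp_all)
  finally show ?thesis by (simp only: distrib_right mult.assoc)
qed

lemma affine_interpolation:
  fixes \<beta> :: "'a::euclidean_space \<Rightarrow> real"
  assumes "\<not> affine_dependent C"
  obtains g c where "linear g" "\<And>v. v \<in> C \<Longrightarrow> g v + c = \<beta> v"
proof (cases "C = {}")
  case True
  then show ?thesis using that[of "\<lambda>_. 0" 0] by (simp add: linear_zero)
next
  case False
  then obtain a where a: "a \<in> C" by blast
  have "independent ((\<lambda>x. - a + x) ` (C - {a}))"
    using assms affine_dependent_iff_dependent2[OF a] by blast
  from linear_independent_extend[OF this, of "\<lambda>x. \<beta> (a + x) - \<beta> a"]
  obtain g where g: "linear g" "\<And>x. x \<in> (\<lambda>x. - a + x) ` (C - {a}) \<Longrightarrow> g x = \<beta> (a + x) - \<beta> a" by blast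
  show ?thesis
  proof (rule that[OF g(1), of "\<beta> a - g a"])
    fix v assume "v \<in> C"
    show "g v + (\<beta> a - g a) = \<beta> v"
    proof (cases "v = a")
      case False
      then have "g (- a + v) = \<beta> (a + (- a + v)) - \<beta> a" using \<open>v \<in> C\<close> by (intro g(2)) blast
      moreover have "g (- a + v) = g v - g a" using linear_diff[OF g(1), of v a] by simp
      ultimately show ?thesis by simp
    qed simp
  qed
qed

text \<open>
  Two affine pieces agree on the common face of their simplices because they agree at the vertices of
  this face, which are vertices of both simplices.
\<close>

lemma triangulation_interpolant:
  fixes \<S> :: "'a::euclidean_space set set" and \<beta> :: "'a \<Rightarrow> real"
  assumes tri: "triangulation \<S>"
  obtains u where "u \<in> borel_measurable borel"
    "\<And>S. S \<in> \<S> \<Longrightarrow> \<exists>g c. linear g \<and> (\<forall>x\<in>S. u x = g x + c)"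
    "\<And>S v. S \<in> \<S> \<Longrightarrow> v extreme_point_of S \<Longrightarrow> u v = \<beta> v"
proof -
  have fin: "finite \<S>" and sim: "\<And>S. S \<in> \<S> \<Longrightarrow> \<exists>n. n simplex S"
    and face: "\<And>S S'. S \<in> \<S> \<Longrightarrow> S' \<in> \<S> \<Longrightarrow> (S \<inter> S') face_of S"
    using tri by (simp_all add: triangulation_def)
  have "\<exists>g c. linear g \<and> (\<forall>v. v extreme_point_of S \<longrightarrow> g v + c = \<beta> v)" if "S \<in> \<S>" for S
  proof -
    obtain C where C: "\<not> affine_dependent C" "S = convex hull C"
      using sim[OF \<open>S \<in> \<S>\<close>] by (auto simp: simplex_def)
    obtain g c where "linear g" "\<And>v. v \<in> C \<Longrightarrow> g v + c = \<beta> v" by (rule affine_interpolation[OF C(1), where \<beta> = \<beta>]) blast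
    then show ?thesis
      using extreme_point_of_convex_hull_affine_independent[OF C(1)] C(2) by blast
  qed
  then obtain g c where lin: "\<And>S. S \<in> \<S> \<Longrightarrow> linear (g S)"
    and val: "\<And>S v. S \<in> \<S> \<Longrightarrow> v extreme_point_of S \<Longrightarrow> g S v + c S = \<beta> v"
    by metis
  have comp: "compact S" "convex S" if "S \<in> \<S>" for S
    using sim[OF that] compact_simplex convex_simplex by blast+
  have agree: "g S x + c S = g S' x + c S'" if S: "S \<in> \<S>" "S' \<in> \<S>" and x: "x \<in> S" "x \<in> S'" for S S' x
  proof -
    let ?F = "S \<inter> S'" and ?A = "{y. g S y + c S = g S' y + c S'}"
    have F: "?F face_of S" "?F face_of S'" using face[OF S] face[OF S(2,1)] by (simp_all add: Int_commute)
    have "{v. v extreme_point_of ?F} \<subseteq> ?A"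
    proof
      fix v assume "v \<in> {v. v extreme_point_of ?F}"
      then have "v extreme_point_of S" "v extreme_point_of S'"
        using extreme_point_of_face[OF F(1)] extreme_point_of_face[OF F(2)] by blast+
      then show "v \<in> ?A" using val[OF S(1)] val[OF S(2)] by simp
    qed
    moreover have "convex ?A"
    proof -
      have "linear (\<lambda>y. g S y - g S' y)" using lin S by (intro linear_compose_sub) simp_all
      then have "convex ((\<lambda>y. g S y - g S' y) -` {c S' - c S})" by (rule convex_linear_vimage) simp
      moreover have "(\<lambda>y. g S y - g S' y) -` {c S' - c S} = ?A" by (auto simp: algebra_simps)
      ultimately show ?thesis by simp
    qed
    ultimately have "convex hull {v. v extreme_point_of ?F} \<subseteq> ?A" by (rule hull_minimal)
    moreover have "?F = convex hull {v. v extreme_point_of ?F}"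
      using comp S by (intro Krein_Milman_Minkowski compact_Int convex_Int) simp_all
    ultimately show ?thesis using x by blast
  qed
  define u where "u x = (if x \<in> \<Union>\<S> then (let S = SOME S. S \<in> \<S> \<and> x \<in> S in g S x + c S) else 0)" for x
  have u: "u x = g S x + c S" if "S \<in> \<S>" "x \<in> S" for S x
  proof -
    let ?S = "SOME S. S \<in> \<S> \<and> x \<in> S"
    have "?S \<in> \<S> \<and> x \<in> ?S" using that by (rule_tac someI[of _ S]) simp
    then have "g ?S x + c ?S = g S x + c S" using agree[of ?S S x] that by simp
    moreover have "x \<in> \<Union>\<S>" using that by blast
    ultimately show ?thesis by (simp add: u_def Let_def)
  qed
  have cont: "continuous_on (\<Union>S\<in>\<S>. S) u"
  proof (rule continuous_on_closed_Union)
    fix S assume S: "S \<in> \<S>"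
    show "closed S" using comp[OF S] by (simp add: compact_imp_closed)
    have "continuous_on S (\<lambda>x. g S x + c S)"
      using lin[OF S] by (intro continuous_intros linear_continuous_on) (simp add: linear_linear)
    then show "continuous_on S u" using u[OF S] by (simp cong: continuous_on_cong)
  qed (rule fin)
  have "closed (\<Union>\<S>)" using fin comp by (intro closed_Union) (simp_all add: compact_imp_closed)
  then have "(\<lambda>x. indicator (\<Union>\<S>) x *\<^sub>R u x) \<in> borel_measurable borel"
    using cont by (intro borel_measurable_continuous_on_indicator) simp_all
  moreover have "(\<lambda>x. indicator (\<Union>\<S>) x *\<^sub>R u x) = u"
    by (rule ext) (simp add: u_def indicator_def)
  ultimately have "u \<in> borel_measurable borel" by simp
  moreover have "\<exists>g c. linear g \<and> (\<forall>x\<in>S. u x = g x + c)" if "S \<in> \<S>" for S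
    using lin[OF that] u[OF that] by blast
  moreover have "u v = \<beta> v" if "S \<in> \<S>" "v extreme_point_of S" for S v
    using u[OF that(1), of v] val[OF that] that(2) by (simp add: extreme_point_of_def)
  ultimately show ?thesis by (rule that)
qed

text \<open>
  The oscillation of an affine function over \<open>S\<close> is attained at extreme points.  The slope in a
  direction is the oscillation over the diameter of the ball in that direction, divided by \<open>2 * r\<close>.
\<close>

lemma affine_on_imp_lipschitz:
  fixes S :: "'a::euclidean_space set" and u :: "'a \<Rightarrow> real"
  assumes S: "compact S" "convex S" and g: "linear g" and u: "\<And>x. x \<in> S \<Longrightarrow> u x = g x + c"
    and r: "0 < r" "ball p r \<subseteq> S"
    and M: "\<And>v w. v extreme_point_of S \<Longrightarrow> w extreme_point_of S \<Longrightarrow> \<bar>u v - u w\<bar> \<le> M"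
    and xy: "x \<in> S" "y \<in> S"
  shows "\<bar>u x - u y\<bar> \<le> M / (2 * r) * dist x y"
proof -
  let ?V = "{v. v extreme_point_of S}"
  have hull: "S = convex hull ?V" using S by (rule Krein_Milman_Minkowski)
  have conv: "convex {y. \<bar>g a - g y\<bar> \<le> M}" for a
  proof -
    have "convex (g -` {g a - M..g a + M})" using g by (rule convex_linear_vimage) simp
    moreover have "g -` {g a - M..g a + M} = {y. \<bar>g a - g y\<bar> \<le> M}" by (auto simp: abs_le_iff)
    ultimately show ?thesis by simp
  qed
  have VS: "?V \<subseteq> S" by (auto simp: extreme_point_of_def)
  have osc: "\<bar>g a - g b\<bar> \<le> M" if "a \<in> S" "b \<in> S" for a b
  proof -
    have 1: "\<bar>g v - g b\<bar> \<le> M" if "v \<in> ?V" "b \<in> S" for v b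
    proof -
      have "?V \<subseteq> {y. \<bar>g v - g y\<bar> \<le> M}"
      proof
        fix w assume "w \<in> ?V"
        then have "v \<in> S" "w \<in> S" "\<bar>u v - u w\<bar> \<le> M" using \<open>v \<in> ?V\<close> VS M by auto
        then show "w \<in> {y. \<bar>g v - g y\<bar> \<le> M}" using u by simp
      qed
      then have "convex hull ?V \<subseteq> {y. \<bar>g v - g y\<bar> \<le> M}" using conv by (rule hull_minimal)
      then show ?thesis using \<open>b \<in> S\<close> hull by blast
    qed
    have "?V \<subseteq> {y. \<bar>g b - g y\<bar> \<le> M}"
      using 1[OF _ \<open>b \<in> S\<close>] by (auto simp: abs_minus_commute)
    then have "convex hull ?V \<subseteq> {y. \<bar>g b - g y\<bar> \<le> M}" using conv by (rule hull_minimal)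
    then have "\<bar>g b - g a\<bar> \<le> M" using \<open>a \<in> S\<close> hull by blast
    then show ?thesis by (simp add: abs_minus_commute)
  qed
  have cball: "cball p r \<subseteq> S"
    using closure_minimal[OF r(2)] S(1) r(1) by (simp add: compact_imp_closed)
  show ?thesis
  proof (cases "x = y")
    case False
    define e where "e = (x - y) /\<^sub>R norm (x - y)"
    have e: "norm e = 1" "x - y = dist x y *\<^sub>R e" using False by (simp_all add: e_def dist_norm)
    have "p + r *\<^sub>R e \<in> cball p r" "p - r *\<^sub>R e \<in> cball p r"
      using e r(1) by (simp_all add: dist_norm)
    then have "\<bar>g (p + r *\<^sub>R e) - g (p - r *\<^sub>R e)\<bar> \<le> M" using cball osc by blast
    moreover have "g (p + r *\<^sub>R e) - g (p - r *\<^sub>R e) = 2 * r * g e"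
      using g by (simp add: linear_add linear_diff linear_cmul)
    ultimately have "2 * r * \<bar>g e\<bar> \<le> M" using r(1) by (simp add: abs_mult)
    then have ge: "\<bar>g e\<bar> \<le> M / (2 * r)" using r(1) by (simp add: field_simps)
    have "u x - u y = g (x - y)" using u xy g by (simp add: linear_diff)
    also have "\<dots> = dist x y * g e" using e(2) g by (metis linear_cmul real_scaleR_def)
    finally have "\<bar>u x - u y\<bar> = \<bar>g e\<bar> * dist x y" by (simp add: abs_mult)
    also have "\<dots> \<le> M / (2 * r) * dist x y" using ge by (rule mult_right_mono) simp
    finally show ?thesis .
  qed simp
qed

lemma tetrahedron_facts:
  assumes "3 simplex (S :: (real^3) set)"
  shows "interior S \<noteq> {}" "closure (interior S) = S" "0 < diameter S"
    "finite {v. v extreme_point_of S}" "card {v. v extreme_point_of S} = 4"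
proof -
  obtain C where C: "finite C" "\<not> affine_dependent C" "card C = 4" "S = convex hull C"
    using assms by (auto simp: simplex)
  have V: "{v. v extreme_point_of S} = C"
    using extreme_point_of_convex_hull_affine_independent[OF C(2)] C(4) by simp
  then show "finite {v. v extreme_point_of S}" "card {v. v extreme_point_of S} = 4" using C by simp_all
  have S: "convex S" "compact S" using assms by (simp_all add: convex_simplex compact_simplex)
  have "aff_dim S = int (DIM(real^3))" using aff_dim_simplex[OF assms] by simp
  then have "rel_interior S = interior S" by (rule interior_rel_interior)
  moreover have "S \<noteq> {}" using C by auto
  ultimately show int: "interior S \<noteq> {}" using rel_interior_eq_empty[OF S(1)] by simp
  then show "closure (interior S) = S"
    using convex_closure_interior[OF S(1)] S(2) by (simp add: compact_imp_closed)
  have "\<not> card C \<le> Suc 0" using C(3) by simp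
  then obtain a b where "a \<in> C" "b \<in> C" "a \<noteq> b" using card_le_Suc0_iff_eq[OF C(1)] by blast
  moreover have "C \<subseteq> S" using C(4) hull_subset by simp
  ultimately have "dist a b \<le> diameter S" using S(2)
    by (intro diameter_bounded_bound) (auto simp: compact_imp_bounded)
  then show "0 < diameter S" using \<open>a \<noteq> b\<close> by (metis less_le_trans zero_less_dist_iff)
qed

lemma ball_in_set_inradius:
  assumes "r < inradius S" "0 \<le> r"
  shows "\<exists>x. ball x r \<subseteq> S"
proof -
  have "0 \<in> {r. 0 \<le> r \<and> (\<exists>x. ball x r \<subseteq> S)}" by simp
  then have "\<exists>s\<in>{r. 0 \<le> r \<and> (\<exists>x. ball x r \<subseteq> S)}. r < s"
    using assms(1) unfolding inradius_def by (intro less_cSupD) blast+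
  then obtain s x where "r < s" "ball x s \<subseteq> S" by blast
  moreover have "ball x r \<subseteq> ball x s" using \<open>r < s\<close> by (intro subset_ball) simp
  ultimately show ?thesis by blast
qed

lemma emeasure_le_diameter:
  fixes S :: "(real^3) set"
  assumes "bounded S"
  shows "emeasure lborel S \<le> ennreal (unit_ball_vol 3 * diameter S ^ 3)"
proof (cases "S = {}")
  case False
  then obtain x where "x \<in> S" by blast
  then have "S \<subseteq> cball x (diameter S)"
    using diameter_bounded_bound[OF assms] by (simp add: subset_iff)
  then have "emeasure lborel S \<le> emeasure lborel (cball x (diameter S))"
    by (intro emeasure_mono) simp_all
  also have "\<dots> = ennreal (unit_ball_vol 3 * diameter S ^ 3)"
    using diameter_ge_0[OF assms] by (simp add: emeasure_cball)
  finally show ?thesis .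
qed simp

lemma nn_integral_interior_convex:
  fixes S :: "'a::euclidean_space set"
  assumes "convex S"
  shows "(\<integral>\<^sup>+x\<in>interior S. f x \<partial>lborel) = (\<integral>\<^sup>+x\<in>S. f x \<partial>lborel)"
proof -
  have "frontier S \<in> null_sets lborel"
    using negligible_convex_frontier[OF assms] by (simp add: negligible_iff_null_sets null_sets_completion_iff)
  then have "AE x in lborel. x \<notin> frontier S" by (rule AE_not_in)
  then show ?thesis
  proof (intro nn_integral_cong_AE, elim eventually_mono)
    fix x assume "x \<notin> frontier S"
    then have "x \<in> interior S \<longleftrightarrow> x \<in> S"
      using closure_subset[of S] interior_subset[of S] unfolding frontier_def by blast
    then show "f x * indicator (interior S) x = f x * indicator S x" by (simp add: indicator_def)
  qed
qed

section \<open>The edge graph of an element\<close>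

text \<open>
  Connectedness of the intersection graph of the cover.  If \<open>P\<close> failed somewhere, the union over the
  indices with \<open>P\<close> and the union over the other indices would separate the connected union.
\<close>

lemma connected_finite_closed_cover_induct:
  fixes X :: "'i \<Rightarrow> 'a::topological_space set"
  assumes "finite I" and X: "\<And>i. i \<in> I \<Longrightarrow> closed (X i) \<and> X i \<noteq> {}" and conn: "connected (\<Union>i\<in>I. X i)"
    and ij: "i \<in> I" "j \<in> I" and "P i"
    and step: "\<And>k l. k \<in> I \<Longrightarrow> l \<in> I \<Longrightarrow> P k \<Longrightarrow> X k \<inter> X l \<noteq> {} \<Longrightarrow> P l"
  shows "P j"
proof (rule ccontr)
  assume "\<not> P j"
  let ?A = "\<Union>k\<in>{k \<in> I. P k}. X k" and ?B = "\<Union>k\<in>{k \<in> I. \<not> P k}. X k"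
  have A: "closed ?A" by (rule closed_UN) (use \<open>finite I\<close> X in simp_all)
  have B: "closed ?B" by (rule closed_UN) (use \<open>finite I\<close> X in simp_all)
  have disj: "?A \<inter> ?B \<inter> (\<Union>i\<in>I. X i) = {}"
  proof (rule ccontr)
    assume "?A \<inter> ?B \<inter> (\<Union>i\<in>I. X i) \<noteq> {}"
    then obtain k l where kl: "k \<in> I" "P k" "l \<in> I" "\<not> P l" "X k \<inter> X l \<noteq> {}" by blast
    show False using step[OF kl(1,3,2,5)] kl(4) by simp
  qed
  have cover: "(\<Union>i\<in>I. X i) \<subseteq> ?A \<union> ?B" by blast
  obtain x where "x \<in> X i" using X[OF ij(1)] by (meson ex_in_conv)
  then have "x \<in> ?A \<inter> (\<Union>i\<in>I. X i)" using ij(1) \<open>P i\<close> by (intro IntI UN_I[of i]) simp_all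
  moreover obtain y where "y \<in> X j" using X[OF ij(2)] by (meson ex_in_conv)
  then have "y \<in> ?B \<inter> (\<Union>i\<in>I. X i)" using ij(2) \<open>\<not> P j\<close> by (intro IntI UN_I[of j]) simp_all
  ultimately show False using connected_closedD[OF conn disj cover A B] by (metis emptyE)
qed

text \<open>
  The relative interior of the union contains the relative interior of each of the simplices, as all
  of them span the same affine subspace.
\<close>

lemma polytopal_set_facts:
  fixes P :: "'a::euclidean_space set"
  assumes "polytopal_set n P" "0 \<le> n"
  shows "aff_dim P = n" "P \<noteq> {}" "bounded P"
proof -
  obtain \<S> where S: "finite \<S>" "\<And>S. S \<in> \<S> \<Longrightarrow> n simplex S" "aff_dim (\<Union>\<S>) = n" "P = rel_interior (\<Union>\<S>)"
    using assms(1) unfolding polytopal_set_def by blast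
  have "\<Union>\<S> \<noteq> {}" using S(3) assms(2) by (metis aff_dim_empty neg_0_le_iff_le not_one_le_zero)
  then obtain S where SS: "S \<in> \<S>" by blast
  have sub: "S \<subseteq> \<Union>\<S>" using SS by blast
  have "aff_dim S = n" using S(2)[OF SS] by (rule aff_dim_simplex)
  then have "affine hull S = affine hull (\<Union>\<S>)" using aff_dim_eq_full_gen[OF sub] S(3) by simp
  then have "rel_interior S \<subseteq> P" using subset_rel_interior[OF sub] S(4) by simp
  then have "aff_dim (rel_interior S) \<le> aff_dim P" by (rule aff_dim_subset)
  moreover have "aff_dim (rel_interior S) = n"
    using rel_interior_aff_dim[OF convex_simplex[OF S(2)[OF SS]]] \<open>aff_dim S = n\<close> by simp
  moreover have PS: "P \<subseteq> \<Union>\<S>" using S(4) rel_interior_subset by blast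
  then have "aff_dim P \<le> n" using aff_dim_subset S(3) by metis
  ultimately show "aff_dim P = n" by simp
  then show "P \<noteq> {}" using assms(2) by auto
  have "\<forall>S\<in>\<S>. bounded S" using S(2) compact_imp_bounded compact_simplex by blast
  then have "bounded (\<Union>\<S>)" using S(1) by blast
  then show "bounded P" using PS bounded_subset by blast
qed

lemma aff_dim_open_segment:
  fixes a b :: "'a::euclidean_space"
  assumes "a \<noteq> b" shows "aff_dim (open_segment a b) = 1"
proof -
  have "aff_dim (open_segment a b) = aff_dim (affine hull {a, b})"
    using assms by (metis aff_dim_affine_hull affine_hull_open_segment)
  then show ?thesis using assms by simp
qed

context
  fixes \<Omega> :: "(real^3) set" and \<T> \<F> \<E> :: "(real^3) set set" and \<V> :: "(real^3) set"
    and \<tau> :: "(real^3) set \<Rightarrow> real^3"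
  assumes mesh: "polyhedral_mesh \<Omega> \<T> \<F> \<E> \<V> \<tau>"
begin

lemma mesh_facts:
  shows "finite \<T>" "finite \<F>" "finite \<E>"
    and "pairwise disjnt (\<T> \<union> \<F> \<union> \<E> \<union> (\<lambda>V. {V}) ` \<V>)"
    and "\<forall>T\<in>\<T>. polytopal_set 3 T \<and> connected T \<and> connected (frontier T)"
    and "(\<Union>T\<in>\<T>. closure T) = closure \<Omega>"
    and "\<forall>F\<in>\<F>. polytopal_set 2 F \<and> connected F \<and> connected (rel_frontier F)"
    and "\<forall>T\<in>\<T>. \<exists>\<G>\<subseteq>\<F>. frontier T = (\<Union>F\<in>\<G>. closure F)"
    and "\<forall>E\<in>\<E>. \<exists>V1 V2. oriented_edge \<tau> E V1 V2"
    and "\<forall>F\<in>\<F>. \<exists>\<D>\<subseteq>\<E>. rel_frontier F = (\<Union>E\<in>\<D>. closure E)"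
    and "\<V> = {V. \<exists>W. V \<noteq> W \<and> open_segment V W \<in> \<E>}"
  using mesh[unfolded polyhedral_mesh_def] by - (elim conjE, assumption)+

text \<open>
  Disjointness requires the entities to be distinct as sets.  For entities of different kinds this
  is seen from their affine dimensions, which the lemmas below compare.
\<close>

lemma mesh_disjoint:
  assumes "Y \<in> \<T> \<union> \<F> \<union> \<E> \<union> (\<lambda>V. {V}) ` \<V>" "Z \<in> \<T> \<union> \<F> \<union> \<E> \<union> (\<lambda>V. {V}) ` \<V>" "Y \<noteq> Z"
  shows "Y \<inter> Z = {}"
  using pairwiseD[OF mesh_facts(4) assms] by (simp add: disjnt_def)

lemma element_facts:
  assumes "T \<in> \<T>"
  shows "aff_dim T = 3" "T \<noteq> {}" "bounded T" "connected (frontier T)"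
    "\<exists>\<G>\<subseteq>\<F>. frontier T = (\<Union>F\<in>\<G>. closure F)"
proof -
  have T: "polytopal_set 3 T" using bspec[OF mesh_facts(5) assms] by (elim conjE)
  show "aff_dim T = 3" "T \<noteq> {}" "bounded T" using polytopal_set_facts[OF T] by simp_all
  show "connected (frontier T)" using bspec[OF mesh_facts(5) assms] by (elim conjE)
  show "\<exists>\<G>\<subseteq>\<F>. frontier T = (\<Union>F\<in>\<G>. closure F)" using assms by (rule bspec[OF mesh_facts(8)])
qed

lemma face_facts:
  assumes "F \<in> \<F>"
  shows "aff_dim F = 2" "F \<noteq> {}" "bounded F" "connected (rel_frontier F)"
    "\<exists>\<D>\<subseteq>\<E>. rel_frontier F = (\<Union>E\<in>\<D>. closure E)"
proof -
  have F: "polytopal_set 2 F" using bspec[OF mesh_facts(7) assms] by (elim conjE)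
  show "aff_dim F = 2" "F \<noteq> {}" "bounded F" using polytopal_set_facts[OF F] by simp_all
  show "connected (rel_frontier F)" using bspec[OF mesh_facts(7) assms] by (elim conjE)
  show "\<exists>\<D>\<subseteq>\<E>. rel_frontier F = (\<Union>E\<in>\<D>. closure E)" using assms by (rule bspec[OF mesh_facts(10)])
qed

lemma open_segment_endpoint_vertex:
  assumes "V \<noteq> W" "open_segment V W \<in> \<E>"
  shows "V \<in> \<V>" "W \<in> \<V>"
proof -
  have "V \<noteq> W \<and> open_segment V W \<in> \<E>" "W \<noteq> V \<and> open_segment W V \<in> \<E>"
    using assms by (simp_all add: open_segment_commute[of W V])
  then show "V \<in> \<V>" "W \<in> \<V>" using equalityD2[OF mesh_facts(11)] by blast+
qed

lemma edge_cases:
  assumes "E \<in> \<E>"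
  obtains V W where "V \<noteq> W" "E = open_segment V W" "V \<in> \<V>" "W \<in> \<V>"
    "closure E = E \<union> {V, W}" "oriented_edge \<tau> E V W"
proof -
  obtain V W where VW: "oriented_edge \<tau> E V W"
    using bspec[OF mesh_facts(9) assms] by blast
  then have E: "V \<noteq> W" "E = open_segment V W" by (simp_all add: oriented_edge_def)
  have seg: "open_segment V W \<in> \<E>" using E(2) assms by simp
  have cl: "closure E = E \<union> {V, W}" using E by (simp add: closed_segment_eq_open)
  show ?thesis by (rule that[OF E open_segment_endpoint_vertex[OF E(1) seg] cl VW])
qed

lemma vertex_not_in_edge: "E \<in> \<E> \<Longrightarrow> V \<in> \<V> \<Longrightarrow> V \<notin> E"
proof -
  assume E: "E \<in> \<E>" and V: "V \<in> \<V>"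
  have "aff_dim E = 1" by (rule edge_cases[OF E]) (simp add: aff_dim_open_segment)
  then have "E \<noteq> {V}" by auto
  then have "E \<inter> {V} = {}" using E V by (intro mesh_disjoint) blast+
  then show "V \<notin> E" by blast
qed

lemma vertex_not_in_face: "F \<in> \<F> \<Longrightarrow> V \<in> \<V> \<Longrightarrow> V \<notin> F"
proof -
  assume F: "F \<in> \<F>" and V: "V \<in> \<V>"
  have "F \<noteq> {V}" using face_facts(1)[OF F] by auto
  then have "F \<inter> {V} = {}" using F V by (intro mesh_disjoint) blast+
  then show "V \<notin> F" by blast
qed

lemma vertex_not_in_element: "T \<in> \<T> \<Longrightarrow> V \<in> \<V> \<Longrightarrow> V \<notin> T"
proof -
  assume T: "T \<in> \<T>" and V: "V \<in> \<V>"
  have "T \<noteq> {V}" using element_facts(1)[OF T] by auto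
  then have "T \<inter> {V} = {}" using T V by (intro mesh_disjoint) blast+
  then show "V \<notin> T" by blast
qed

lemma edge_face_disjoint: "E \<in> \<E> \<Longrightarrow> F \<in> \<F> \<Longrightarrow> E \<inter> F = {}"
proof -
  assume E: "E \<in> \<E>" and F: "F \<in> \<F>"
  have "aff_dim E = 1" by (rule edge_cases[OF E]) (simp add: aff_dim_open_segment)
  then have "E \<noteq> F" using face_facts(1)[OF F] by auto
  then show "E \<inter> F = {}" using E F by (intro mesh_disjoint) blast+
qed

lemma face_element_disjoint: "F \<in> \<F> \<Longrightarrow> T \<in> \<T> \<Longrightarrow> F \<inter> T = {}"
proof -
  assume F: "F \<in> \<F>" and T: "T \<in> \<T>"
  have "F \<noteq> T" using face_facts(1)[OF F] element_facts(1)[OF T] by auto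
  then show "F \<inter> T = {}" using F T by (intro mesh_disjoint) blast+
qed

lemma closure_face_subset: "closure F \<subseteq> F \<union> rel_frontier F"
  using rel_interior_subset unfolding rel_frontier_def by blast

lemma rel_frontier_subset_closure: "rel_frontier F \<subseteq> closure F"
  unfolding rel_frontier_def by blast

lemma rel_frontier_face_disjoint_face:
  assumes "F \<in> \<F>" "F' \<in> \<F>" shows "F \<inter> rel_frontier F' = {}"
proof (rule ccontr)
  assume "F \<inter> rel_frontier F' \<noteq> {}"
  then obtain x where x: "x \<in> F" "x \<in> rel_frontier F'" by blast
  obtain \<D> where "\<D> \<subseteq> \<E>" "rel_frontier F' = (\<Union>E\<in>\<D>. closure E)" using face_facts(5)[OF assms(2)] by blast
  then obtain E where E: "E \<in> \<E>" "x \<in> closure E" using x by blast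
  obtain V W where "V \<in> \<V>" "W \<in> \<V>" "closure E = E \<union> {V, W}" by (rule edge_cases[OF E(1)]) blast
  then have "x \<in> E \<or> x \<in> \<V>" using E(2) by blast
  then show False using x(1) edge_face_disjoint[OF E(1) assms(1)] vertex_not_in_face[OF assms(1)] by blast
qed

text \<open>
  The entities are disjoint, so the closures of different edges can only have endpoints in common.
\<close>

lemma edges_meet_at_vertex:
  assumes E: "E \<in> \<E>" "E' \<in> \<E>" and meet: "closure E \<inter> closure E' \<noteq> {}"
  shows "\<exists>V\<in>\<V>. V \<in> closure E \<and> V \<in> closure E'"
proof -
  obtain V W where VW: "V \<in> \<V>" "W \<in> \<V>" "closure E = E \<union> {V, W}" by (rule edge_cases[OF E(1)]) blast
  obtain V' W' where VW': "V' \<in> \<V>" "W' \<in> \<V>" "closure E' = E' \<union> {V', W'}" by (rule edge_cases[OF E(2)]) blast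
  show ?thesis
  proof (cases "E = E'")
    case True then show ?thesis using VW by blast
  next
    case False
    then have "E \<inter> E' = {}" using E by (intro mesh_disjoint) blast+
    obtain x where x: "x \<in> closure E" "x \<in> closure E'" using meet by blast
    have "x \<in> \<V>" using x VW VW' \<open>E \<inter> E' = {}\<close> by blast
    then show ?thesis using x by blast
  qed
qed

text \<open>
  A common point of two closed faces cannot lie in either of the open faces, so it lies on the
  contours of both, that is, on two closed edges.
\<close>

lemma faces_meet_at_vertex:
  assumes F: "F \<in> \<F>" "F' \<in> \<F>" "F \<noteq> F'" and meet: "closure F \<inter> closure F' \<noteq> {}"
  shows "\<exists>V\<in>\<V>. V \<in> rel_frontier F \<and> V \<in> rel_frontier F'"
proof -
  obtain x where x: "x \<in> closure F" "x \<in> closure F'" using meet by blast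
  have "F \<inter> F' = {}" using F by (intro mesh_disjoint) blast+
  then have x': "x \<in> rel_frontier F" "x \<in> rel_frontier F'"
    using x closure_face_subset[of F] closure_face_subset[of F']
      rel_frontier_face_disjoint_face[OF F(1,2)] rel_frontier_face_disjoint_face[OF F(2,1)] by blast+
  obtain \<D> where D: "\<D> \<subseteq> \<E>" "rel_frontier F = (\<Union>E\<in>\<D>. closure E)" using face_facts(5)[OF F(1)] by blast
  obtain \<D>' where D': "\<D>' \<subseteq> \<E>" "rel_frontier F' = (\<Union>E\<in>\<D>'. closure E)" using face_facts(5)[OF F(2)] by blast
  obtain E E' where E: "E \<in> \<D>" "x \<in> closure E" "E' \<in> \<D>'" "x \<in> closure E'" using x' D D' by blast
  then obtain V where "V \<in> \<V>" "V \<in> closure E" "V \<in> closure E'"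
    using edges_meet_at_vertex[of E E'] D(1) D'(1) by blast
  then show ?thesis using D(2) D'(2) E by blast
qed

definition edge_rel :: "(real^3) set \<Rightarrow> ((real^3) \<times> (real^3)) set" where
  "edge_rel T = {(V, W). V \<noteq> W \<and> open_segment V W \<in> edges_of \<E> T}"

lemma edge_rel_subset: "edge_rel T \<subseteq> vertices_of \<V> T \<times> vertices_of \<V> T"
proof
  fix p assume "p \<in> edge_rel T"
  then obtain V W where p: "p = (V, W)" "V \<noteq> W" "open_segment V W \<in> \<E>" "open_segment V W \<subseteq> frontier T"
    by (auto simp: edge_rel_def edges_of_def)
  have "V \<in> \<V>" "W \<in> \<V>" using open_segment_endpoint_vertex[OF p(2,3)] by simp_all
  moreover have "closed_segment V W \<subseteq> frontier T"
    using closure_minimal[OF p(4)] p(2) by simp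
  then have "V \<in> frontier T" "W \<in> frontier T" by auto
  ultimately show "p \<in> vertices_of \<V> T \<times> vertices_of \<V> T" using p(1) by (simp add: vertices_of_def)
qed

lemma edge_rel_endpoints:
  assumes "E \<in> \<E>" "closure E \<subseteq> frontier T" "V \<in> \<V>" "W \<in> \<V>" "V \<in> closure E" "W \<in> closure E"
  shows "(V, W) \<in> (edge_rel T)\<^sup>*"
proof -
  obtain A B where AB: "A \<noteq> B" "E = open_segment A B" "closure E = E \<union> {A, B}"
    by (rule edge_cases[OF assms(1)]) blast
  have "V \<in> {A, B}" "W \<in> {A, B}" using assms(3-6) AB(3) vertex_not_in_edge[OF assms(1)] by blast+
  moreover have "E \<in> edges_of \<E> T" using assms(1,2) closure_subset by (auto simp: edges_of_def)
  then have "(A, B) \<in> edge_rel T" "(B, A) \<in> edge_rel T"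
    using AB by (auto simp: edge_rel_def open_segment_commute)
  ultimately show ?thesis by auto
qed

text \<open>
  The closed edges of the face cover its connected contour, and neighbouring ones share a vertex.
\<close>

lemma face_vertices_connected:
  assumes F: "F \<in> \<F>" "closure F \<subseteq> frontier T" and V: "V \<in> \<V>" "V \<in> rel_frontier F"
    and W: "W \<in> \<V>" "W \<in> rel_frontier F"
  shows "(V, W) \<in> (edge_rel T)\<^sup>*"
proof -
  obtain \<D> where D: "\<D> \<subseteq> \<E>" "rel_frontier F = (\<Union>E\<in>\<D>. closure E)" using face_facts(5)[OF F(1)] by blast
  have cl: "closure E \<subseteq> frontier T" if "E \<in> \<D>" for E
    using that D(2) F(2) rel_frontier_subset_closure[of F] by blast
  obtain E1 E2 where E: "E1 \<in> \<D>" "V \<in> closure E1" "E2 \<in> \<D>" "W \<in> closure E2" using V W D(2) by blast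
  have "\<forall>Z\<in>\<V>. Z \<in> closure E2 \<longrightarrow> (V, Z) \<in> (edge_rel T)\<^sup>*"
  proof (rule connected_finite_closed_cover_induct[where I = \<D> and X = closure and i = E1 and P = "\<lambda>E. \<forall>Z\<in>\<V>. Z \<in> closure E \<longrightarrow> (V, Z) \<in> (edge_rel T)\<^sup>*"])
    show "finite \<D>" using D(1) mesh_facts(3) by (rule finite_subset)
    show "closed (closure E) \<and> closure E \<noteq> {}" if E: "E \<in> \<D>" for E
    proof
      have "E \<in> \<E>" using E D(1) by blast
      then obtain A B where "closure E = E \<union> {A, B}" by (rule edge_cases)
      then have "A \<in> closure E" by simp
      then show "closure E \<noteq> {}" by (metis empty_iff)
    qed simp
    show "connected (\<Union>E\<in>\<D>. closure E)" using face_facts(4)[OF F(1)] D(2) by simp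
    show "\<forall>Z\<in>\<V>. Z \<in> closure E1 \<longrightarrow> (V, Z) \<in> (edge_rel T)\<^sup>*"
      using edge_rel_endpoints[of E1 T V] E D(1) cl V by blast
    fix E E' assume EE: "E \<in> \<D>" "E' \<in> \<D>" "\<forall>Z\<in>\<V>. Z \<in> closure E \<longrightarrow> (V, Z) \<in> (edge_rel T)\<^sup>*"
      and meet: "closure E \<inter> closure E' \<noteq> {}"
    obtain X where X: "X \<in> \<V>" "X \<in> closure E" "X \<in> closure E'"
      using edges_meet_at_vertex[of E E'] EE D(1) meet by blast
    then have "(V, X) \<in> (edge_rel T)\<^sup>*" using EE(3) by blast
    moreover have "(X, Z) \<in> (edge_rel T)\<^sup>*" if "Z \<in> \<V>" "Z \<in> closure E'" for Z
      using edge_rel_endpoints[of E' T X Z] that X EE D(1) cl by blast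
    ultimately show "\<forall>Z\<in>\<V>. Z \<in> closure E' \<longrightarrow> (V, Z) \<in> (edge_rel T)\<^sup>*"
      by (meson rtrancl_trans)
  qed (use E in auto)
  then show ?thesis using W E by blast
qed

text \<open>
  The closed faces of the element cover its connected boundary.  Neighbouring faces share a vertex,
  and the vertices of a single face are already known to be connected.
\<close>

lemma element_vertices_connected:
  assumes T: "T \<in> \<T>" and V: "V \<in> vertices_of \<V> T" and W: "W \<in> vertices_of \<V> T"
  shows "(V, W) \<in> (edge_rel T)\<^sup>*"
proof -
  obtain \<G> where G: "\<G> \<subseteq> \<F>" "frontier T = (\<Union>F\<in>\<G>. closure F)" using element_facts(5)[OF T] by blast
  have cl: "closure F \<subseteq> frontier T" if "F \<in> \<G>" for F using that G(2) by blast
  have rf: "Z \<in> rel_frontier F" if "F \<in> \<G>" "Z \<in> \<V>" "Z \<in> closure F" for F Z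
    using that closure_face_subset[of F] vertex_not_in_face[of F Z] G(1) by blast
  obtain F1 F2 where F: "F1 \<in> \<G>" "V \<in> closure F1" "F2 \<in> \<G>" "W \<in> closure F2"
    using V W G(2) unfolding vertices_of_def by blast
  have VW: "V \<in> \<V>" "W \<in> \<V>" using V W by (simp_all add: vertices_of_def)
  have "\<forall>Z\<in>\<V>. Z \<in> rel_frontier F2 \<longrightarrow> (V, Z) \<in> (edge_rel T)\<^sup>*"
  proof (rule connected_finite_closed_cover_induct[where I = \<G> and X = closure and i = F1 and P = "\<lambda>F. \<forall>Z\<in>\<V>. Z \<in> rel_frontier F \<longrightarrow> (V, Z) \<in> (edge_rel T)\<^sup>*"])
    show "finite \<G>" using G(1) mesh_facts(2) by (rule finite_subset)
    show "closed (closure F) \<and> closure F \<noteq> {}" if "F \<in> \<G>" for F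
      using face_facts(2)[of F] that G(1) by auto
    show "connected (\<Union>F\<in>\<G>. closure F)" using element_facts(4)[OF T] G(2) by simp
    show "\<forall>Z\<in>\<V>. Z \<in> rel_frontier F1 \<longrightarrow> (V, Z) \<in> (edge_rel T)\<^sup>*"
      using face_vertices_connected[of F1 T V] F G(1) cl VW rf by blast
    fix F F' assume FF: "F \<in> \<G>" "F' \<in> \<G>" "\<forall>Z\<in>\<V>. Z \<in> rel_frontier F \<longrightarrow> (V, Z) \<in> (edge_rel T)\<^sup>*"
      and meet: "closure F \<inter> closure F' \<noteq> {}"
    show "\<forall>Z\<in>\<V>. Z \<in> rel_frontier F' \<longrightarrow> (V, Z) \<in> (edge_rel T)\<^sup>*"
    proof (cases "F = F'")
      case False
      obtain X where X: "X \<in> \<V>" "X \<in> rel_frontier F" "X \<in> rel_frontier F'"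
        using faces_meet_at_vertex[of F F'] FF G(1) meet False by blast
      then have "(V, X) \<in> (edge_rel T)\<^sup>*" using FF(3) by blast
      moreover have "(X, Z) \<in> (edge_rel T)\<^sup>*" if "Z \<in> \<V>" "Z \<in> rel_frontier F'" for Z
        using face_vertices_connected[of F' T X Z] that X FF G(1) cl by blast
      ultimately show ?thesis by (meson rtrancl_trans)
    qed (use FF in simp)
  qed (use F in auto)
  then show ?thesis using VW F rf by blast
qed

lemma edge_rel_jump:
  assumes "(V, W) \<in> edge_rel T"
  shows "(\<alpha> V - \<alpha> W)\<^sup>2 \<le> (\<Sum>E\<in>edges_of \<E> T. \<bar>edge_jump \<tau> \<alpha> E\<bar>\<^sup>2)"
proof -
  let ?E = "open_segment V W"
  have E: "V \<noteq> W" "?E \<in> edges_of \<E> T" using assms by (simp_all add: edge_rel_def)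
  then have "?E \<in> \<E>" by (simp add: edges_of_def)
  then obtain A B where AB: "?E = open_segment A B" "oriented_edge \<tau> ?E A B" by (rule edge_cases) blast
  have "{V, W} = {A, B}" using AB(1) by (metis open_segment_eq E(1))
  then have "(\<alpha> V - \<alpha> W)\<^sup>2 = (\<alpha> B - \<alpha> A)\<^sup>2" by (auto simp: doubleton_eq_iff power2_commute)
  also have "\<dots> = \<bar>edge_jump \<tau> \<alpha> ?E\<bar>\<^sup>2" using edge_jump_eq[OF AB(2)] by simp
  also have "\<dots> \<le> (\<Sum>E\<in>edges_of \<E> T. \<bar>edge_jump \<tau> \<alpha> E\<bar>\<^sup>2)"
    using E(2) mesh_facts(3) by (intro member_le_sum) (simp_all add: edges_of_def)
  finally show ?thesis .
qed

end

section \<open>Elements and their tetrahedra\<close>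

text \<open>
  A polytopal domain is the interior of a closed set, which makes it equal to the interior of its
  closure.  The pieces in the last claim are the interiors of the tetrahedra that define \<open>\<Omega>\<close>.
\<close>

lemma polytopal_domain:
  fixes \<Omega> :: "(real^3) set"
  assumes "polytopal_set 3 \<Omega>"
  shows "open \<Omega>" "interior (closure \<Omega>) = \<Omega>"
    and "\<exists>\<D>. finite \<D> \<and> (\<forall>D\<in>\<D>. open D \<and> convex D \<and> bounded D \<and> D \<noteq> {} \<and> D \<subseteq> \<Omega>) \<and> negligible (\<Omega> - \<Union>\<D>)"
proof -
  obtain \<S> where S: "finite \<S>" "\<forall>S\<in>\<S>. 3 simplex S" "aff_dim (\<Union>\<S>) = 3" "\<Omega> = rel_interior (\<Union>\<S>)"
    using assms unfolding polytopal_set_def by blast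
  have \<Omega>: "\<Omega> = interior (\<Union>\<S>)" using S(3,4) by (simp add: interior_rel_interior)
  then show "open \<Omega>" by simp
  have closed: "closed (\<Union>\<S>)" using S(1,2) closed_simplex by (intro closed_Union) blast+
  have "closure \<Omega> \<subseteq> \<Union>\<S>" using closed interior_subset unfolding \<Omega> by (intro closure_minimal)
  then have "interior (closure \<Omega>) \<subseteq> \<Omega>" unfolding \<Omega> by (rule interior_mono)
  moreover have "\<Omega> \<subseteq> interior (closure \<Omega>)" using \<open>open \<Omega>\<close> closure_subset by (intro interior_maximal)
  ultimately show "interior (closure \<Omega>) = \<Omega>" by (rule equalityI)
  show "\<exists>\<D>. finite \<D> \<and> (\<forall>D\<in>\<D>. open D \<and> convex D \<and> bounded D \<and> D \<noteq> {} \<and> D \<subseteq> \<Omega>) \<and> negligible (\<Omega> - \<Union>\<D>)"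
  proof (intro exI[of _ "interior ` \<S>"] conjI ballI)
    fix D assume "D \<in> interior ` \<S>"
    then obtain S where D: "D = interior S" "S \<in> \<S>" by blast
    have sim: "3 simplex S" using S(2) D(2) by blast
    show "open D" using D by simp
    show "convex D" using convex_simplex[OF sim] D(1) convex_interior by simp
    show "bounded D"
      using compact_imp_bounded[OF compact_simplex[OF sim]] D(1) interior_subset bounded_subset by metis
    show "D \<noteq> {}" using tetrahedron_facts(1)[OF sim] D(1) by simp
    show "D \<subseteq> \<Omega>" unfolding D(1) \<Omega> using D(2) by (intro interior_mono) blast
  next
    have "negligible (\<Union>S\<in>\<S>. frontier S)"
      using S(1,2) convex_simplex negligible_convex_frontier by (intro negligible_Union) blast+
    moreover have "\<Omega> - \<Union> (interior ` \<S>) \<subseteq> (\<Union>S\<in>\<S>. frontier S)"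
    proof
      fix x assume x: "x \<in> \<Omega> - \<Union> (interior ` \<S>)"
      then obtain S where "S \<in> \<S>" "x \<in> S" using interior_subset unfolding \<Omega> by blast
      then show "x \<in> (\<Union>S\<in>\<S>. frontier S)" using x closure_subset unfolding frontier_def by blast
    qed
    ultimately show "negligible (\<Omega> - \<Union> (interior ` \<S>))" by (rule negligible_subset)
  qed (use S(1) in simp)
qed

text \<open>
  In a finite relation a path can be chosen with at most \<open>card r\<close> steps.
\<close>

lemma rtrancl_difference_bound:
  fixes \<alpha> :: "'a \<Rightarrow> real"
  assumes "finite r" "(x, y) \<in> r\<^sup>*" "0 \<le> s" and step: "\<And>v w. (v, w) \<in> r \<Longrightarrow> \<bar>\<alpha> v - \<alpha> w\<bar> \<le> s"
  shows "\<bar>\<alpha> x - \<alpha> y\<bar> \<le> real (card r) * s"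
proof -
  have path: "\<bar>\<alpha> x - \<alpha> z\<bar> \<le> real n * s" if "(x, z) \<in> r ^^ n" for n z
    using that
  proof (induction n arbitrary: z)
    case 0
    then show ?case by simp
  next
    case (Suc n)
    obtain w where w: "(x, w) \<in> r ^^ n" "(w, z) \<in> r" using Suc.prems by (rule relpow_Suc_E)
    have "\<bar>\<alpha> x - \<alpha> w\<bar> \<le> real n * s" using w(1) by (rule Suc.IH)
    moreover have "\<bar>\<alpha> w - \<alpha> z\<bar> \<le> s" using w(2) by (rule step)
    ultimately show ?case by (simp add: algebra_simps)
  qed
  obtain n where n: "n \<le> card r" "(x, y) \<in> r ^^ n"
    using assms(2) rtrancl_finite_eq_relpow[OF assms(1)] by blast
  have "\<bar>\<alpha> x - \<alpha> y\<bar> \<le> real n * s" using n(2) by (rule path)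
  also have "\<dots> \<le> real (card r) * s" using n(1) assms(3) by (intro mult_right_mono) simp_all
  finally show ?thesis .
qed

lemma sum_subset_UN_le:
  fixes f :: "'a \<Rightarrow> real"
  assumes "finite I" "\<And>i. i \<in> I \<Longrightarrow> finite (A i)" "B \<subseteq> (\<Union>i\<in>I. A i)" "\<And>x. 0 \<le> f x"
  shows "sum f B \<le> (\<Sum>i\<in>I. sum f (A i))"
proof -
  have "sum f B \<le> sum f (\<Union>i\<in>I. A i)" using assms by (intro sum_mono2) simp_all
  also have "\<dots> \<le> (\<Sum>i\<in>I. sum f (A i))"
    using assms(1,2)
  proof induction
    case (insert i I)
    have "sum f (A i \<union> (\<Union>j\<in>I. A j)) \<le> sum f (A i) + sum f (\<Union>j\<in>I. A j)"
      using sum.union_inter[of "A i" "\<Union>j\<in>I. A j" f] insert.hyps(1) insert.prems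
        sum_nonneg[of "A i \<inter> (\<Union>j\<in>I. A j)" f] assms(4) by simp
    also have "\<dots> \<le> sum f (A i) + (\<Sum>j\<in>I. sum f (A j))" using insert.IH insert.prems by simp
    finally show ?case using insert.hyps by simp
  qed simp
  finally show ?thesis .
qed

lemma sum_nn_integral_disjoint_le:
  assumes f: "f \<in> borel_measurable M" and B: "\<And>i. i \<in> I \<Longrightarrow> B i \<in> sets M" "disjoint_family_on B I"
    and I: "finite I" and \<Omega>: "\<Omega> \<in> sets M" "\<And>i. i \<in> I \<Longrightarrow> B i \<subseteq> \<Omega>"
  shows "(\<Sum>i\<in>I. \<integral>\<^sup>+x\<in>B i. f x \<partial>M) \<le> (\<integral>\<^sup>+x\<in>\<Omega>. f x \<partial>M)"
proof -
  have "(\<Sum>i\<in>I. \<integral>\<^sup>+x\<in>B i. f x \<partial>M) = (\<Sum>i\<in>I. emeasure (density M f) (B i))"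
    using f B(1) by (intro sum.cong refl) (simp add: emeasure_density)
  also have "\<dots> = emeasure (density M f) (\<Union>i\<in>I. B i)"
    using B I by (intro sum_emeasure) (simp_all add: image_subset_iff)
  also have "\<dots> \<le> emeasure (density M f) \<Omega>" using \<Omega> by (intro emeasure_mono) (simp_all add: UN_subset_iff)
  also have "\<dots> = (\<integral>\<^sup>+x\<in>\<Omega>. f x \<partial>M)" using f \<Omega>(1) by (simp add: emeasure_density)
  finally show ?thesis .
qed

context
  fixes \<Omega> :: "(real^3) set" and \<T> \<F> \<E> :: "(real^3) set set" and \<V> :: "(real^3) set"
    and \<tau> :: "(real^3) set \<Rightarrow> real^3" and \<S> :: "(real^3) set set" and \<rho> :: real
    and c :: "(real^3) set \<Rightarrow> real^3"
  assumes mesh: "polyhedral_mesh \<Omega> \<T> \<F> \<E> \<V> \<tau>"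
    and domain: "polytopal_set 3 \<Omega>" and \<rho>: "0 < \<rho>"
    and submesh: "matching_submesh \<Omega> \<T> \<F> \<S>"
    and center: "\<forall>Y\<in>\<T> \<union> \<F>. c Y \<in> Y"
    and old_vertices: "\<V> \<subseteq> {v. \<exists>S\<in>\<S>. v extreme_point_of S}"
    and new_vertices: "{v. \<exists>S\<in>\<S>. v extreme_point_of S} \<subseteq> \<V> \<union> c ` (\<T> \<union> \<F>)"
    and inradius_ge: "\<forall>S\<in>\<S>. \<rho> * diameter S \<le> inradius S"
    and size_ge: "\<forall>S\<in>\<S>. \<forall>T\<in>\<T>. interior S \<subseteq> T \<longrightarrow> \<rho> * diameter T \<le> diameter S"
begin

lemma submesh_triangulation: "triangulation \<S>" "finite \<S>"
  and submesh_simplex: "S \<in> \<S> \<Longrightarrow> 3 simplex S"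
  and Union_submesh: "\<Union>\<S> = closure \<Omega>"
  and simplex_in_element: "S \<in> \<S> \<Longrightarrow> \<exists>T\<in>\<T>. interior S \<subseteq> T"
  using submesh unfolding matching_submesh_def triangulation_def by simp_all

lemma simplex_props:
  assumes "S \<in> \<S>"
  shows "convex S" "compact S" "closed S" "bounded S" "0 < diameter S"
  using submesh_simplex[OF assms] tetrahedron_facts(3)
  by (simp_all add: convex_simplex compact_simplex compact_imp_closed compact_imp_bounded)

lemma face_of_submesh: "S \<in> \<S> \<Longrightarrow> S' \<in> \<S> \<Longrightarrow> (S \<inter> S') face_of S"
  using submesh_triangulation(1) by (simp add: triangulation_def)

definition simplices_of :: "(real^3) set \<Rightarrow> (real^3) set set" where
  "simplices_of T = {S \<in> \<S>. interior S \<subseteq> T}"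

lemma element_open: "T \<in> \<T> \<Longrightarrow> open T"
  using mesh_facts(5)[OF mesh] polytopal_domain(1) by blast

lemma elements_disjoint: "T \<in> \<T> \<Longrightarrow> T' \<in> \<T> \<Longrightarrow> T \<noteq> T' \<Longrightarrow> T \<inter> T' = {}"
  by (rule mesh_disjoint[OF mesh]) simp_all

lemma element_unique:
  assumes "S \<in> \<S>" "T \<in> \<T>" "T' \<in> \<T>" "interior S \<subseteq> T" "interior S \<subseteq> T'"
  shows "T = T'"
  using elements_disjoint[OF assms(2,3)] tetrahedron_facts(1)[OF submesh_simplex[OF assms(1)]] assms(4,5) by blast

lemma simplices_of_subset_closure:
  assumes "S \<in> simplices_of T" shows "S \<subseteq> closure T"
proof -
  have "closure (interior S) \<subseteq> closure T" using assms by (intro closure_mono) (simp add: simplices_of_def)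
  then show ?thesis using tetrahedron_facts(2)[OF submesh_simplex] assms by (simp add: simplices_of_def)
qed

text \<open>
  A tetrahedron that belongs to another element is the closure of its interior, which is disjoint
  from the open set \<open>T\<close>; hence it does not meet \<open>T\<close>.
\<close>

lemma closure_element_subset:
  assumes T: "T \<in> \<T>" shows "closure T \<subseteq> \<Union>(simplices_of T)"
proof (rule closure_minimal)
  have "closed S" if "S \<in> simplices_of T" for S using that simplex_props(3) by (simp add: simplices_of_def)
  moreover have "finite (simplices_of T)" using submesh_triangulation(2) by (simp add: simplices_of_def)
  ultimately show "closed (\<Union>(simplices_of T))" by (intro closed_Union) blast+
  show "T \<subseteq> \<Union>(simplices_of T)"
  proof
    fix x assume x: "x \<in> T"
    then have "x \<in> closure \<Omega>" using mesh_facts(6)[OF mesh] T closure_subset by blast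
    then obtain S where S: "S \<in> \<S>" "x \<in> S" using Union_submesh by blast
    obtain T' where T': "T' \<in> \<T>" "interior S \<subseteq> T'" using simplex_in_element[OF S(1)] by blast
    have "T' = T"
    proof (rule ccontr)
      assume "T' \<noteq> T"
      then have "T \<inter> interior S = {}" using elements_disjoint[OF T T'(1)] T'(2) by blast
      then have "T \<inter> closure (interior S) = {}" using open_Int_closure_eq_empty[OF element_open[OF T]] by simp
      then show False using tetrahedron_facts(2)[OF submesh_simplex[OF S(1)]] S(2) x by blast
    qed
    then show "x \<in> \<Union>(simplices_of T)" using S T'(2) by (auto simp: simplices_of_def)
  qed
qed

lemma interior_simplex_subset: "S \<in> \<S> \<Longrightarrow> interior S \<subseteq> \<Omega>"
  using interior_mono[of S "closure \<Omega>"] Union_submesh polytopal_domain(2)[OF domain] by blast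

lemma interiors_disjoint:
  assumes S: "S \<in> \<S>" "S' \<in> \<S>" "S \<noteq> S'" shows "interior S \<inter> interior S' = {}"
proof (cases "S \<inter> S' = S")
  case True
  then have "S face_of S'" using face_of_submesh[OF S(2,1)] by (simp add: Int_commute)
  then have "S \<inter> interior S' = {}" using S(3) by (rule face_of_disjoint_interior)
  then show ?thesis using interior_subset by blast
next
  case False
  then have "(S \<inter> S') \<inter> interior S = {}" using face_of_submesh[OF S(1,2)] face_of_disjoint_interior by blast
  then show ?thesis using interior_subset by blast
qed

lemma disjoint_interiors: "disjoint_family_on interior \<S>"
  using interiors_disjoint by (simp add: disjoint_family_on_def)

lemma inscribed_ball:
  assumes "S \<in> \<S>" obtains x where "ball x (\<rho> * diameter S / 2) \<subseteq> interior S"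
proof -
  have "0 < \<rho> * diameter S" using \<rho> simplex_props(5)[OF assms] by simp
  then have "\<rho> * diameter S / 2 < inradius S" using bspec[OF inradius_ge assms] by linarith
  then obtain x where "ball x (\<rho> * diameter S / 2) \<subseteq> S"
    using ball_in_set_inradius[of "\<rho> * diameter S / 2" S] \<open>0 < \<rho> * diameter S\<close> by auto
  then have "ball x (\<rho> * diameter S / 2) \<subseteq> interior S" by (intro interior_maximal) simp_all
  then show ?thesis by (rule that)
qed

lemma element_diameter:
  assumes "T \<in> \<T>" shows "0 \<le> diameter T" "S \<in> simplices_of T \<Longrightarrow> diameter S \<le> diameter T"
proof -
  have bd: "bounded T" by (rule element_facts(3)[OF mesh assms])
  then show "0 \<le> diameter T" by (rule diameter_ge_0)
  show "diameter S \<le> diameter T" if "S \<in> simplices_of T"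
    using diameter_subset[OF simplices_of_subset_closure[OF that]] bounded_closure[OF bd] bd by (simp add: diameter_closure)
qed

text \<open>
  By regularity \<open>S\<close> contains a ball of radius \<open>\<rho> h\<^sub>S / 2 \<ge> \<rho>\<^sup>2 h\<^sub>T / 2\<close>.  The radius is half the
  lower bound for the inradius, because a supremum exceeds every smaller number but may itself not be
  attained.
\<close>

lemma emeasure_interior_simplex_ge:
  assumes T: "T \<in> \<T>" and S: "S \<in> simplices_of T"
  shows "ennreal (unit_ball_vol 3 * (\<rho>\<^sup>2 * diameter T / 2) ^ 3) \<le> emeasure lborel (interior S)"
proof -
  have S': "S \<in> \<S>" "interior S \<subseteq> T" using S by (simp_all add: simplices_of_def)
  let ?r = "\<rho> * diameter S / 2"
  have "\<rho> * diameter T \<le> diameter S" using size_ge S' T by blast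
  then have "\<rho> * (\<rho> * diameter T) \<le> \<rho> * diameter S" using \<rho> by (intro mult_left_mono) simp_all
  then have le: "\<rho>\<^sup>2 * diameter T / 2 \<le> ?r" by (simp add: power2_eq_square mult.assoc)
  obtain x where x: "ball x ?r \<subseteq> interior S" using S'(1) by (rule inscribed_ball)
  have pos: "0 \<le> ?r" using \<rho> simplex_props(5)[OF S'(1)] by simp
  have "ennreal (unit_ball_vol 3 * (\<rho>\<^sup>2 * diameter T / 2) ^ 3) \<le> ennreal (unit_ball_vol 3 * ?r ^ 3)"
    using le element_diameter(1)[OF T] by (intro ennreal_leI mult_left_mono power_mono) simp_all
  also have "\<dots> = emeasure lborel (ball x ?r)" using pos by (simp add: emeasure_ball)
  also have "\<dots> \<le> emeasure lborel (interior S)" using x by (intro emeasure_mono) simp_all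
  finally show ?thesis .
qed

lemma element_diameter_pos:
  assumes T: "T \<in> \<T>" shows "0 < diameter T"
proof -
  have "T \<noteq> {}" by (rule element_facts(2)[OF mesh T])
  then obtain S where S: "S \<in> simplices_of T" using closure_element_subset[OF T] closure_subset by blast
  then have "0 < diameter S" using simplex_props(5) by (simp add: simplices_of_def)
  then show ?thesis using element_diameter(2)[OF T S] by linarith
qed

text \<open>
  The tetrahedra in \<open>T\<close> have disjoint interiors, each of volume at least
  \<open>\<kappa> (\<rho>\<^sup>2 h\<^sub>T / 2)\<^sup>3\<close>, while \<open>T\<close> has volume at most \<open>\<kappa> h\<^sub>T\<^sup>3\<close>, where \<open>\<kappa>\<close> is the volume of the unit
  ball.
\<close>

lemma card_simplices_of:
  assumes T: "T \<in> \<T>" shows "real (card (simplices_of T)) \<le> 8 / \<rho> ^ 6"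
proof -
  let ?\<kappa> = "unit_ball_vol 3" and ?h = "diameter T" and ?n = "real (card (simplices_of T))"
  let ?v = "?\<kappa> * (\<rho>\<^sup>2 * ?h / 2) ^ 3"
  have \<kappa>: "0 < ?\<kappa>" by simp
  have h: "0 < ?h" using T by (rule element_diameter_pos)
  have sub: "simplices_of T \<subseteq> \<S>" by (auto simp: simplices_of_def)
  have "ennreal (?n * ?v) = (\<Sum>S\<in>simplices_of T. ennreal ?v)"
    using h \<rho> by (simp add: ennreal_mult ennreal_of_nat_eq_real_of_nat)
  also have "\<dots> \<le> (\<Sum>S\<in>simplices_of T. emeasure lborel (interior S))"
    using emeasure_interior_simplex_ge[OF T] by (rule sum_mono)
  also have "\<dots> = emeasure lborel (\<Union>S\<in>simplices_of T. interior S)"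
    using submesh_triangulation(2) sub disjoint_interiors finite_subset
    by (intro sum_emeasure) (auto intro: disjoint_family_on_mono)
  also have "\<dots> \<le> emeasure lborel T"
    using element_open[OF T] by (intro emeasure_mono) (auto simp: simplices_of_def)
  also have "\<dots> \<le> ennreal (?\<kappa> * ?h ^ 3)" by (rule emeasure_le_diameter[OF element_facts(3)[OF mesh T]])
  finally have "?n * ?v \<le> ?\<kappa> * ?h ^ 3" using h by (simp add: ennreal_le_iff)
  then have "?n * \<rho> ^ 6 * (?\<kappa> * ?h ^ 3) \<le> 8 * (?\<kappa> * ?h ^ 3)"
    by (simp add: power_mult_distrib power_divide power_mult[symmetric] field_simps)
  then have "?n * \<rho> ^ 6 \<le> 8" using \<kappa> h by (simp add: mult_le_cancel_right)
  then show ?thesis using \<rho> by (simp add: pos_le_divide_eq)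
qed

text \<open>
  A mesh vertex is an extreme point of some tetrahedron, possibly in another element.  In a conforming
  submesh it is then an extreme point of every tetrahedron that contains it.
\<close>

lemma vertex_in_simplex:
  assumes T: "T \<in> \<T>" and V: "V \<in> vertices_of \<V> T"
  shows "\<exists>S\<in>simplices_of T. V extreme_point_of S"
proof -
  have "V \<in> closure T" using V by (simp add: vertices_of_def frontier_def)
  then obtain S where S: "S \<in> simplices_of T" "V \<in> S" using closure_element_subset[OF T] by blast
  have "V \<in> \<V>" using V by (simp add: vertices_of_def)
  then obtain S' where S': "S' \<in> \<S>" "V extreme_point_of S'" using old_vertices by blast
  have "S \<in> \<S>" using S(1) by (simp add: simplices_of_def)
  have "V \<in> S'" using S'(2) by (simp add: extreme_point_of_def)
  then have "V extreme_point_of (S' \<inter> S)"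
    using extreme_point_of_face[OF face_of_submesh[OF S'(1) \<open>S \<in> \<S>\<close>]] S'(2) S(2) by blast
  then have "V extreme_point_of S"
    using extreme_point_of_face[OF face_of_submesh[OF \<open>S \<in> \<S>\<close> S'(1)]] by (simp add: Int_commute)
  then show ?thesis using S(1) by blast
qed

text \<open>
  Each of the at most \<open>8 / \<rho> ^ 6\<close> tetrahedra has four vertices.
\<close>

lemma card_vertices_of:
  assumes T: "T \<in> \<T>"
  shows "finite (vertices_of \<V> T)" "real (card (vertices_of \<V> T)) \<le> 32 / \<rho> ^ 6"
proof -
  let ?A = "\<Union>S\<in>simplices_of T. {v. v extreme_point_of S}"
  have fin: "finite (simplices_of T)" using submesh_triangulation(2) by (simp add: simplices_of_def)
  have ext: "finite {v. v extreme_point_of S}" "card {v. v extreme_point_of S} = 4" if "S \<in> simplices_of T" for S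
    using tetrahedron_facts(4,5)[OF submesh_simplex] that by (simp_all add: simplices_of_def)
  have sub: "vertices_of \<V> T \<subseteq> ?A" using vertex_in_simplex[OF T] by blast
  have finA: "finite ?A" using fin ext(1) by simp
  then show "finite (vertices_of \<V> T)" using sub by (rule rev_finite_subset)
  have "card (vertices_of \<V> T) \<le> card ?A" using finA sub by (rule card_mono)
  also have "\<dots> \<le> (\<Sum>S\<in>simplices_of T. card {v. v extreme_point_of S})" using fin by (rule card_UN_le)
  also have "\<dots> = 4 * card (simplices_of T)" using ext(2) by simp
  finally have "real (card (vertices_of \<V> T)) \<le> 4 * real (card (simplices_of T))"
    by (metis of_nat_le_iff of_nat_mult of_nat_numeral)
  also have "\<dots> \<le> 32 / \<rho> ^ 6" using card_simplices_of[OF T] by simp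
  finally show "real (card (vertices_of \<V> T)) \<le> 32 / \<rho> ^ 6" .
qed

text \<open>
  A face without contour would be an affine subspace, but it is bounded and of dimension two.
\<close>

lemma face_has_vertex:
  assumes F: "F \<in> \<F>" shows "\<exists>V\<in>\<V>. V \<in> rel_frontier F"
proof -
  have "\<not> affine F"
    using affine_bounded_eq_lowdim[of F] face_facts(1,3)[OF mesh F] by auto
  then have "rel_frontier F \<noteq> {}" by (simp add: rel_frontier_eq_empty)
  moreover obtain \<D> where D: "\<D> \<subseteq> \<E>" "rel_frontier F = (\<Union>E\<in>\<D>. closure E)"
    using face_facts(5)[OF mesh F] by blast
  ultimately obtain E where E: "E \<in> \<D>" by blast
  then have "E \<in> \<E>" using D(1) by blast
  then obtain A B where "A \<in> \<V>" "closure E = E \<union> {A, B}" by (rule edge_cases[OF mesh])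
  then have "A \<in> closure E" by simp
  then show ?thesis using \<open>A \<in> \<V>\<close> E D(2) by blast
qed

lemma element_has_vertex:
  assumes T: "T \<in> \<T>" shows "\<exists>V. V \<in> vertices_of \<V> T"
proof -
  have "T \<noteq> UNIV" using element_facts(3)[OF mesh T] not_bounded_UNIV by metis
  then have "frontier T \<noteq> {}" using element_facts(2)[OF mesh T] by (simp add: frontier_eq_empty)
  moreover obtain \<G> where G: "\<G> \<subseteq> \<F>" "frontier T = (\<Union>F\<in>\<G>. closure F)"
    using element_facts(5)[OF mesh T] by blast
  ultimately obtain F where F: "F \<in> \<G>" by blast
  then obtain V where V: "V \<in> \<V>" "V \<in> rel_frontier F" using face_has_vertex G(1) by blast
  then have "V \<in> closure F" using rel_frontier_subset_closure[OF mesh] by blast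
  then have "V \<in> frontier T" using F G(2) by blast
  then show ?thesis using V(1) unfolding vertices_of_def by blast
qed

text \<open>
  At a center the value is copied from a vertex of the face or element around it, so that the
  values on an element \<open>T\<close> all come from vertices of \<open>T\<close>.
\<close>

definition vertex_value :: "(real^3 \<Rightarrow> real) \<Rightarrow> real^3 \<Rightarrow> real" where
  "vertex_value \<alpha> v =
     (if v \<in> \<V> then \<alpha> v else \<alpha> (SOME w. w \<in> \<V> \<and> (\<exists>Y\<in>\<T> \<union> \<F>. v \<in> Y \<and> w \<in> closure Y)))"

lemma vertex_closure_element:
  assumes T: "T \<in> \<T>" "v \<in> \<V>" "v \<in> closure T" shows "v \<in> vertices_of \<V> T"
  using vertex_not_in_element[OF mesh T(1,2)] T(2,3) element_open[OF T(1)]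
  by (simp add: vertices_of_def frontier_def interior_open)

text \<open>
  If a point of a face lies in the closure of \<open>T\<close>, then by disjointness the face is one of those that
  make up \<open>\<partial>T\<close>, and its vertices are vertices of \<open>T\<close>.  An element with a point in the closure of \<open>T\<close> is
  \<open>T\<close> itself.
\<close>

lemma closure_of_incident_entity:
  assumes T: "T \<in> \<T>" and v: "v \<in> closure T" and Y: "Y \<in> \<T> \<union> \<F>" "v \<in> Y"
  shows "closure Y \<subseteq> closure T" "\<exists>w\<in>\<V>. w \<in> closure Y"
proof -
  have "closure Y \<subseteq> closure T \<and> (\<exists>w\<in>\<V>. w \<in> closure Y)"
  proof (cases "Y \<in> \<T>")
    case True
    have "Y \<inter> T \<noteq> {}" using open_Int_closure_eq_empty[OF element_open[OF True], of T] v Y(2) by blast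
    then have "Y = T" using elements_disjoint[OF True T] by blast
    moreover obtain w where "w \<in> vertices_of \<V> T" using element_has_vertex[OF T] by blast
    ultimately show ?thesis by (auto simp: vertices_of_def frontier_def)
  next
    case False
    then have F: "Y \<in> \<F>" using Y(1) by blast
    have "v \<notin> T" using face_element_disjoint[OF mesh F T] Y(2) by blast
    then have "v \<in> frontier T" using v element_open[OF T] by (simp add: frontier_def interior_open)
    moreover obtain \<G> where G: "\<G> \<subseteq> \<F>" "frontier T = (\<Union>F\<in>\<G>. closure F)"
      using element_facts(5)[OF mesh T] by blast
    ultimately obtain F where FG: "F \<in> \<G>" "v \<in> closure F" by blast
    have F': "F \<in> \<F>" using FG(1) G(1) by blast
    have "v \<notin> rel_frontier F" using rel_frontier_face_disjoint_face[OF mesh F F'] Y(2) by blast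
    then have "v \<in> F" using FG(2) closure_face_subset[OF mesh, of F] by blast
    have "F = Y"
    proof (rule ccontr)
      assume "F \<noteq> Y"
      then have "F \<inter> Y = {}" using F F' by (intro mesh_disjoint[OF mesh]) simp_all
      then show False using \<open>v \<in> F\<close> Y(2) by blast
    qed
    then have "closure Y \<subseteq> frontier T" using FG(1) G(2) by blast
    moreover have "frontier T \<subseteq> closure T" by (simp add: frontier_def)
    moreover obtain w where "w \<in> \<V>" "w \<in> rel_frontier Y" using face_has_vertex[OF F] by blast
    ultimately show ?thesis using rel_frontier_subset_closure[OF mesh, of Y] by blast
  qed
  then show "closure Y \<subseteq> closure T" "\<exists>w\<in>\<V>. w \<in> closure Y" by simp_all
qed

lemma vertex_value_in_element:
  assumes T: "T \<in> \<T>" and S: "S \<in> simplices_of T" and v: "v extreme_point_of S"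
  shows "\<exists>w\<in>vertices_of \<V> T. vertex_value \<alpha> v = \<alpha> w"
proof -
  have "v \<in> S" using v by (simp add: extreme_point_of_def)
  then have vT: "v \<in> closure T" using simplices_of_subset_closure[OF S] by blast
  show ?thesis
  proof (cases "v \<in> \<V>")
    case True
    then show ?thesis using vertex_closure_element[OF T True vT] by (auto simp: vertex_value_def)
  next
    case False
    have "S \<in> \<S>" using S by (simp add: simplices_of_def)
    then have "v \<in> c ` (\<T> \<union> \<F>)" using new_vertices v False by blast
    then obtain Y where Y: "Y \<in> \<T> \<union> \<F>" "v \<in> Y" using center by blast
    let ?P = "\<lambda>w. w \<in> \<V> \<and> (\<exists>Y\<in>\<T> \<union> \<F>. v \<in> Y \<and> w \<in> closure Y)"
    have "\<exists>w. ?P w" using closure_of_incident_entity(2)[OF T vT Y] Y by blast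
    then have P: "?P (SOME w. ?P w)" by (rule someI_ex)
    then have "(SOME w. ?P w) \<in> closure T" using closure_of_incident_entity(1)[OF T vT] by blast
    then have "(SOME w. ?P w) \<in> vertices_of \<V> T" using vertex_closure_element[OF T] P by blast
    then show ?thesis using False by (auto simp: vertex_value_def)
  qed
qed

definition jump_sum :: "(real^3 \<Rightarrow> real) \<Rightarrow> (real^3) set \<Rightarrow> real" where
  "jump_sum \<alpha> T = (\<Sum>E\<in>edges_of \<E> T. \<bar>edge_jump \<tau> \<alpha> E\<bar>\<^sup>2)"

lemma jump_sum_nonneg: "0 \<le> jump_sum \<alpha> T"
  unfolding jump_sum_def by (intro sum_nonneg) simp

text \<open>
  An element has at most \<open>32 / \<rho> ^ 6\<close> vertices, so a path of edges between two of them can be chosen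
  with at most \<open>(32 / \<rho> ^ 6)\<^sup>2\<close> steps, and each step changes the value by at most the square root of
  the sum of all squared jumps.
\<close>

lemma element_oscillation:
  assumes T: "T \<in> \<T>" and VW: "V \<in> vertices_of \<V> T" "W \<in> vertices_of \<V> T"
  shows "\<bar>\<alpha> V - \<alpha> W\<bar> \<le> (32 / \<rho> ^ 6)\<^sup>2 * sqrt (jump_sum \<alpha> T)"
proof -
  let ?r = "edge_rel \<E> T"
  have sub: "?r \<subseteq> vertices_of \<V> T \<times> vertices_of \<V> T" by (rule edge_rel_subset[OF mesh])
  have fin: "finite (vertices_of \<V> T \<times> vertices_of \<V> T)" using card_vertices_of(1)[OF T] by simp
  have "card ?r \<le> card (vertices_of \<V> T \<times> vertices_of \<V> T)" using fin sub by (rule card_mono)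
  then have "real (card ?r) \<le> real (card (vertices_of \<V> T)) * real (card (vertices_of \<V> T))"
    by (metis card_cartesian_product of_nat_le_iff of_nat_mult)
  also have "\<dots> \<le> (32 / \<rho> ^ 6) * (32 / \<rho> ^ 6)"
    using card_vertices_of(2)[OF T] \<rho> by (intro mult_mono) simp_all
  finally have card: "real (card ?r) \<le> (32 / \<rho> ^ 6)\<^sup>2" by (simp only: power2_eq_square)
  have "\<bar>\<alpha> V - \<alpha> W\<bar> \<le> real (card ?r) * sqrt (jump_sum \<alpha> T)"
  proof (rule rtrancl_difference_bound)
    show "finite ?r" using fin sub by (rule rev_finite_subset)
    show "(V, W) \<in> ?r\<^sup>*" by (rule element_vertices_connected[OF mesh T VW])
    show "0 \<le> sqrt (jump_sum \<alpha> T)" using jump_sum_nonneg by simp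
    show "\<bar>\<alpha> v - \<alpha> w\<bar> \<le> sqrt (jump_sum \<alpha> T)" if "(v, w) \<in> ?r" for v w
      using edge_rel_jump[OF mesh that, of \<alpha>] by (intro real_le_rsqrt) (simp add: jump_sum_def)
  qed
  also have "\<dots> \<le> (32 / \<rho> ^ 6)\<^sup>2 * sqrt (jump_sum \<alpha> T)"
    using card jump_sum_nonneg by (intro mult_right_mono) simp_all
  finally show ?thesis .
qed

lemma simplex_oscillation:
  assumes T: "T \<in> \<T>" and S: "S \<in> simplices_of T" and "v extreme_point_of S" "w extreme_point_of S"
  shows "\<bar>vertex_value \<alpha> v - vertex_value \<alpha> w\<bar> \<le> (32 / \<rho> ^ 6)\<^sup>2 * sqrt (jump_sum \<alpha> T)"
proof -
  obtain V W where "V \<in> vertices_of \<V> T" "vertex_value \<alpha> v = \<alpha> V"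
    "W \<in> vertices_of \<V> T" "vertex_value \<alpha> w = \<alpha> W"
    using vertex_value_in_element[OF T S] assms(3,4) by metis
  then show ?thesis using element_oscillation[OF T] by simp
qed

lemma sum_submesh:
  fixes f :: "(real^3) set \<Rightarrow> 'b::comm_monoid_add"
  shows "(\<Sum>S\<in>\<S>. f S) = (\<Sum>T\<in>\<T>. \<Sum>S\<in>simplices_of T. f S)"
proof -
  have "\<S> = (\<Union>T\<in>\<T>. simplices_of T)" using simplex_in_element by (auto simp: simplices_of_def)
  then have "(\<Sum>S\<in>\<S>. f S) = sum f (\<Union>T\<in>\<T>. simplices_of T)" by simp
  also have "\<dots> = (\<Sum>T\<in>\<T>. \<Sum>S\<in>simplices_of T. f S)"
  proof (rule sum.UNION_disjoint)
    show "finite \<T>" by (rule mesh_facts(1)[OF mesh])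
    show "\<forall>T\<in>\<T>. finite (simplices_of T)" using submesh_triangulation(2) by (simp add: simplices_of_def)
    show "\<forall>T\<in>\<T>. \<forall>T'\<in>\<T>. T \<noteq> T' \<longrightarrow> simplices_of T \<inter> simplices_of T' = {}"
      using element_unique unfolding simplices_of_def by blast
  qed
  finally show ?thesis .
qed

section \<open>Estimates for the interpolant\<close>

text \<open>
  The volume of \<open>S\<close> is comparable to \<open>h\<^sub>T\<^sup>3\<close>: the factor is \<open>528 = 8 * 66\<close>, where the \<open>8\<close> comes from
  the ball of half the inradius and \<open>66 = 8 * 2 ^ 3 + 2\<close> from the estimate of a vertex value by an
  integral.
\<close>

lemma simplex_value_bound:
  assumes u: "u \<in> borel_measurable borel" and aff: "\<exists>g d. linear g \<and> (\<forall>x\<in>S. u x = g x + d)"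
    and T: "T \<in> \<T>" and S: "S \<in> simplices_of T" and v: "v extreme_point_of S"
  shows "ennreal (diameter T ^ 3 * (u v - C)\<^sup>2)
    \<le> ennreal (528 / (unit_ball_vol 3 * \<rho> ^ 6)) * (\<integral>\<^sup>+x\<in>interior S. ennreal ((u x - C)\<^sup>2) \<partial>lborel)"
proof -
  let ?\<kappa> = "unit_ball_vol 3" and ?h = "diameter T" and ?q = "(u v - C)\<^sup>2"
  let ?I = "\<integral>\<^sup>+x\<in>S. ennreal ((u x - C)\<^sup>2) \<partial>lborel"
  have S': "S \<in> \<S>" using S by (simp add: simplices_of_def)
  have vS: "v \<in> S" using v by (simp add: extreme_point_of_def)
  obtain g d where g: "linear g" "\<And>x. x \<in> S \<Longrightarrow> u x = g x + d" using aff by blast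
  have mid: "u (midpoint v y) - C = ((u v - C) + (u y - C)) / 2" if "y \<in> S" for y
  proof -
    have "midpoint v y \<in> S" by (rule subsetD[OF closed_segment_subset[OF vS that simplex_props(1)[OF S']]]) simp
    moreover have "g (midpoint v y) = (g v + g y) / 2"
      using g(1) by (simp add: midpoint_def linear_cmul linear_add)
    ultimately show ?thesis using g(2) vS that by (simp add: field_simps)
  qed
  have "emeasure lborel S * ennreal ?q \<le> (8 * 2 ^ DIM(real^3) + 2) * ?I"
    by (rule value_at_point_le_integral) (use simplex_props[OF S'] vS u mid in simp_all)
  then have q: "emeasure lborel S * ennreal ?q \<le> 66 * ?I" by simp
  have pos: "0 < ?\<kappa>" "0 < \<rho>" "0 < ?h" using \<rho> element_diameter_pos[OF T] by simp_all
  have "h ^ 3 * q = 8 / (k * \<rho> ^ 6) * (k * (\<rho>\<^sup>2 * h / 2) ^ 3 * q)" if "0 < k" for h q k :: real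
    using that \<rho> by (simp add: power_mult_distrib power_divide power_mult[symmetric])
  from this[OF pos(1)] have "?h ^ 3 * ?q = 8 / (?\<kappa> * \<rho> ^ 6) * (?\<kappa> * (\<rho>\<^sup>2 * ?h / 2) ^ 3 * ?q)" .
  then have "ennreal (?h ^ 3 * ?q) = ennreal (8 / (?\<kappa> * \<rho> ^ 6)) * (ennreal (?\<kappa> * (\<rho>\<^sup>2 * ?h / 2) ^ 3) * ennreal ?q)"
    using pos by (simp add: ennreal_mult[symmetric] del: times_divide_eq_left)
  also have "\<dots> \<le> ennreal (8 / (?\<kappa> * \<rho> ^ 6)) * (emeasure lborel S * ennreal ?q)"
  proof (intro mult_left_mono mult_right_mono)
    have "emeasure lborel (interior S) \<le> emeasure lborel S"
      using interior_subset simplex_props(3)[OF S'] by (intro emeasure_mono) simp_all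
    then show "ennreal (?\<kappa> * (\<rho>\<^sup>2 * ?h / 2) ^ 3) \<le> emeasure lborel S"
      using emeasure_interior_simplex_ge[OF T S] by (rule order_trans[rotated])
  qed simp_all
  also have "\<dots> \<le> ennreal (8 / (?\<kappa> * \<rho> ^ 6)) * (66 * ?I)" using q by (intro mult_left_mono) simp_all
  also have "\<dots> = ennreal (8 / (?\<kappa> * \<rho> ^ 6) * 66) * ?I"
    using pos by (subst ennreal_mult) (simp_all add: mult.assoc)
  finally show ?thesis by (simp add: nn_integral_interior_convex[OF simplex_props(1)[OF S']])
qed

text \<open>
  Every vertex of \<open>T\<close> is a vertex of a tetrahedron in \<open>T\<close>.  Each tetrahedron serves for at most four
  vertices, and the integrals over the tetrahedra add up because their interiors are disjoint.
\<close>

lemma vertex_sum_le_integral: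
  assumes u: "u \<in> borel_measurable borel"
    and aff: "\<And>S. S \<in> \<S> \<Longrightarrow> \<exists>g d. linear g \<and> (\<forall>x\<in>S. u x = g x + d)"
    and val: "\<And>S v. S \<in> \<S> \<Longrightarrow> v extreme_point_of S \<Longrightarrow> u v = vertex_value \<alpha> v"
  shows "ennreal (\<Sum>T\<in>\<T>. diameter T ^ 3 * (\<Sum>V\<in>vertices_of \<V> T. (\<alpha> V - C)\<^sup>2))
    \<le> ennreal (2112 / (unit_ball_vol 3 * \<rho> ^ 6)) * (\<integral>\<^sup>+x\<in>\<Omega>. ennreal ((u x - C)\<^sup>2) \<partial>lborel)"
proof -
  let ?ext = "\<lambda>S. {v. v extreme_point_of S}"
  let ?c = "ennreal (528 / (unit_ball_vol 3 * \<rho> ^ 6))"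
  let ?I = "\<lambda>A. \<integral>\<^sup>+x\<in>A. ennreal ((u x - C)\<^sup>2) \<partial>lborel"
  have elem: "ennreal (diameter T ^ 3 * (\<Sum>V\<in>vertices_of \<V> T. (\<alpha> V - C)\<^sup>2))
      \<le> (\<Sum>S\<in>simplices_of T. 4 * ?c * ?I (interior S))" if T: "T \<in> \<T>" for T
  proof -
    have sim: "3 simplex S" "S \<in> \<S>" if "S \<in> simplices_of T" for S
      using that submesh_simplex by (simp_all add: simplices_of_def)
    have uV: "u V = \<alpha> V" if V: "V \<in> vertices_of \<V> T" for V
    proof -
      obtain S where S: "S \<in> simplices_of T" "V extreme_point_of S" using vertex_in_simplex[OF T V] by blast
      have "u V = vertex_value \<alpha> V" using val[OF sim(2)[OF S(1)] S(2)] .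
      then show ?thesis using V by (simp add: vertex_value_def vertices_of_def)
    qed
    have "diameter T ^ 3 * (\<Sum>V\<in>vertices_of \<V> T. (\<alpha> V - C)\<^sup>2)
        = (\<Sum>V\<in>vertices_of \<V> T. diameter T ^ 3 * (u V - C)\<^sup>2)"
      by (subst sum_distrib_left) (rule sum.cong[OF refl], simp add: uV)
    also have "\<dots> \<le> (\<Sum>S\<in>simplices_of T. \<Sum>v\<in>?ext S. diameter T ^ 3 * (u v - C)\<^sup>2)"
    proof (rule sum_subset_UN_le)
      show "finite (simplices_of T)" using submesh_triangulation(2) by (simp add: simplices_of_def)
      show "finite (?ext S)" if "S \<in> simplices_of T" for S using tetrahedron_facts(4)[OF sim(1)[OF that]] .
      show "vertices_of \<V> T \<subseteq> (\<Union>S\<in>simplices_of T. ?ext S)" using vertex_in_simplex[OF T] by blast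
      show "0 \<le> diameter T ^ 3 * (u v - C)\<^sup>2" for v using element_diameter(1)[OF T] by simp
    qed
    finally have "ennreal (diameter T ^ 3 * (\<Sum>V\<in>vertices_of \<V> T. (\<alpha> V - C)\<^sup>2))
        \<le> ennreal (\<Sum>S\<in>simplices_of T. \<Sum>v\<in>?ext S. diameter T ^ 3 * (u v - C)\<^sup>2)" by (rule ennreal_leI)
    also have "\<dots> = (\<Sum>S\<in>simplices_of T. \<Sum>v\<in>?ext S. ennreal (diameter T ^ 3 * (u v - C)\<^sup>2))"
      using element_diameter(1)[OF T] by (simp add: sum_nonneg)
    also have "\<dots> \<le> (\<Sum>S\<in>simplices_of T. \<Sum>v\<in>?ext S. ?c * ?I (interior S))"
    proof (intro sum_mono)
      fix S v assume S: "S \<in> simplices_of T" and v: "v \<in> ?ext S"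
      show "ennreal (diameter T ^ 3 * (u v - C)\<^sup>2) \<le> ?c * ?I (interior S)"
        using v by (intro simplex_value_bound[OF u aff[OF sim(2)[OF S]] T S]) simp
    qed
    also have "\<dots> = (\<Sum>S\<in>simplices_of T. 4 * ?c * ?I (interior S))"
      by (rule sum.cong[OF refl]) (simp add: tetrahedron_facts(5)[OF sim(1)] mult.assoc)
    finally show ?thesis .
  qed
  have "ennreal (\<Sum>T\<in>\<T>. diameter T ^ 3 * (\<Sum>V\<in>vertices_of \<V> T. (\<alpha> V - C)\<^sup>2))
      = (\<Sum>T\<in>\<T>. ennreal (diameter T ^ 3 * (\<Sum>V\<in>vertices_of \<V> T. (\<alpha> V - C)\<^sup>2)))"
    using element_diameter(1) by (intro sum_ennreal[symmetric] mult_nonneg_nonneg sum_nonneg) simp_all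
  also have "\<dots> \<le> (\<Sum>T\<in>\<T>. \<Sum>S\<in>simplices_of T. 4 * ?c * ?I (interior S))" using elem by (rule sum_mono)
  also have "\<dots> = 4 * ?c * (\<Sum>S\<in>\<S>. ?I (interior S))"
    by (subst sum_submesh[symmetric]) (simp only: sum_distrib_left)
  also have "\<dots> \<le> 4 * ?c * ?I \<Omega>"
  proof (intro mult_left_mono sum_nn_integral_disjoint_le)
    show "(\<lambda>x. ennreal ((u x - C)\<^sup>2)) \<in> borel_measurable lborel" using u by simp
    show "\<Omega> \<in> sets lborel" using polytopal_domain(1)[OF domain] by simp
  qed (simp_all add: disjoint_interiors submesh_triangulation(2) interior_simplex_subset)
  also have "4 * ?c = ennreal (2112 / (unit_ball_vol 3 * \<rho> ^ 6))"
  proof -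
    have "4 * ?c = ennreal (4 * (528 / (unit_ball_vol 3 * \<rho> ^ 6)))" using \<rho> by (subst ennreal_mult) simp_all
    then show ?thesis by simp
  qed
  finally show ?thesis .
qed

text \<open>
  On a tetrahedron \<open>S\<close> inside \<open>T\<close> the slope of \<open>u\<close> is at most the oscillation on \<open>T\<close> divided by
  \<open>\<rho> h\<^sub>S\<close>, and the volume of \<open>S\<close> is of order \<open>h\<^sub>S\<^sup>3\<close>.  The contribution of \<open>S\<close> to the energy
  is therefore of order \<open>h\<^sub>S \<le> h\<^sub>T\<close> times the sum of the squared jumps.
\<close>

lemma interpolant_energy:
  assumes u: "u \<in> borel_measurable borel"
    and aff: "\<And>S. S \<in> \<S> \<Longrightarrow> \<exists>g d. linear g \<and> (\<forall>x\<in>S. u x = g x + d)"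
    and val: "\<And>S v. S \<in> \<S> \<Longrightarrow> v extreme_point_of S \<Longrightarrow> u v = vertex_value \<alpha> v"
  shows "\<exists>e. energy_density \<Omega> u e \<and>
    (\<integral>\<^sup>+x\<in>\<Omega>. e x \<partial>lborel)
    \<le> ennreal (unit_ball_vol 3 / \<rho>\<^sup>2 * (32 / \<rho> ^ 6) ^ 4 * (8 / \<rho> ^ 6) * (\<Sum>T\<in>\<T>. diameter T * jump_sum \<alpha> T))"
proof -
  define elt where "elt S = (SOME T. T \<in> \<T> \<and> interior S \<subseteq> T)" for S
  have elt: "elt S \<in> \<T>" "S \<in> simplices_of (elt S)" if "S \<in> \<S>" for S
  proof -
    have "\<exists>T. T \<in> \<T> \<and> interior S \<subseteq> T" using simplex_in_element[OF that] by blast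
    then have "elt S \<in> \<T> \<and> interior S \<subseteq> elt S" unfolding elt_def by (rule someI_ex)
    then show "elt S \<in> \<T>" "S \<in> simplices_of (elt S)" using that by (simp_all add: simplices_of_def)
  qed
  have elt_eq: "elt S = T" if "T \<in> \<T>" "S \<in> simplices_of T" for S T
    using that elt[of S] element_unique[of S "elt S" T] by (simp add: simplices_of_def)
  define M where "M T = (32 / \<rho> ^ 6)\<^sup>2 * sqrt (jump_sum \<alpha> T)" for T
  define L where "L S = M (elt S) / (\<rho> * diameter S)" for S
  have M2: "(M T)\<^sup>2 = (32 / \<rho> ^ 6) ^ 4 * jump_sum \<alpha> T" for T
    unfolding M_def using jump_sum_nonneg by (simp add: power_mult_distrib power_mult[symmetric] del: power_divide)
  let ?e = "\<lambda>z. \<Sum>S\<in>\<S>. ennreal ((L S)\<^sup>2) * indicator S z"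
  let ?a = "unit_ball_vol 3 / \<rho>\<^sup>2 * (32 / \<rho> ^ 6) ^ 4"
  have a: "0 \<le> ?a" using \<rho> by simp
  have "energy_density \<Omega> u ?e"
  proof (rule energy_density_piecewise_lipschitz[OF u submesh_triangulation(2)])
    show "closed S \<and> convex S" if "S \<in> \<S>" for S using simplex_props[OF that] by simp
    show "\<Omega> \<subseteq> \<Union>\<S>" using Union_submesh closure_subset by simp
    fix S x y assume S: "S \<in> \<S>" and xy: "x \<in> S" "y \<in> S"
    obtain g d where g: "linear g" "\<And>x. x \<in> S \<Longrightarrow> u x = g x + d" using aff[OF S] by blast
    obtain p where p: "ball p (\<rho> * diameter S / 2) \<subseteq> interior S" using S by (rule inscribed_ball)
    have "\<bar>u x - u y\<bar> \<le> M (elt S) / (2 * (\<rho> * diameter S / 2)) * dist x y"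
    proof (rule affine_on_imp_lipschitz[OF _ _ g _ _ _ xy])
      show "0 < \<rho> * diameter S / 2" using \<rho> simplex_props(5)[OF S] by simp
      show "ball p (\<rho> * diameter S / 2) \<subseteq> S" using p interior_subset by blast
      show "\<bar>u v - u w\<bar> \<le> M (elt S)" if "v extreme_point_of S" "w extreme_point_of S" for v w
        using simplex_oscillation[OF elt[OF S] that] val[OF S] that by (simp add: M_def)
    qed (use simplex_props[OF S] in simp_all)
    then show "\<bar>u x - u y\<bar> \<le> L S * dist x y" by (simp add: L_def)
  qed
  moreover have "(\<integral>\<^sup>+x\<in>\<Omega>. ?e x \<partial>lborel)
    \<le> ennreal (?a * (8 / \<rho> ^ 6) * (\<Sum>T\<in>\<T>. diameter T * jump_sum \<alpha> T))"
  proof -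
    have "(\<integral>\<^sup>+x\<in>\<Omega>. ?e x \<partial>lborel) \<le> (\<integral>\<^sup>+x. ?e x \<partial>lborel)"
      by (intro nn_integral_mono) (simp add: indicator_def)
    also have "\<dots> = (\<Sum>S\<in>\<S>. ennreal ((L S)\<^sup>2) * emeasure lborel S)"
      using simplex_props(3) by (subst nn_integral_sum) (simp_all add: nn_integral_cmult_indicator cong: sum.cong)
    also have "\<dots> \<le> (\<Sum>S\<in>\<S>. ennreal (?a * (diameter (elt S) * jump_sum \<alpha> (elt S))))"
    proof (rule sum_mono)
      fix S assume S: "S \<in> \<S>"
      have h: "0 < diameter S" "diameter S \<le> diameter (elt S)"
        using simplex_props(5)[OF S] element_diameter(2)[OF elt[OF S]] by simp_all
      have "ennreal ((L S)\<^sup>2) * emeasure lborel S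
        \<le> ennreal ((L S)\<^sup>2) * ennreal (unit_ball_vol 3 * diameter S ^ 3)"
        using emeasure_le_diameter[OF simplex_props(4)[OF S]] by (rule mult_left_mono) simp
      also have "\<dots> = ennreal ((L S)\<^sup>2 * (unit_ball_vol 3 * diameter S ^ 3))"
        by (rule ennreal_mult[symmetric]) (use h in simp_all)
      also have "(L S)\<^sup>2 * (unit_ball_vol 3 * diameter S ^ 3) = ?a * (diameter S * jump_sum \<alpha> (elt S))"
      proof -
        have L2: "(L S)\<^sup>2 = (32 / \<rho> ^ 6) ^ 4 * jump_sum \<alpha> (elt S) / (\<rho>\<^sup>2 * (diameter S)\<^sup>2)"
          unfolding L_def by (simp only: power_divide[of "M _"] M2 power_mult_distrib)
        have alg: "N * J / (r\<^sup>2 * h\<^sup>2) * (k * h ^ 3) = k / r\<^sup>2 * N * (h * J)"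
          if "0 < h" "0 < r" for N J k h r :: real
          using that by (simp add: power3_eq_cube power2_eq_square)
        show ?thesis unfolding L2 by (rule alg[OF h(1) \<rho>])
      qed
      also have "ennreal \<dots> \<le> ennreal (?a * (diameter (elt S) * jump_sum \<alpha> (elt S)))"
        using h(2) a jump_sum_nonneg by (intro ennreal_leI mult_left_mono mult_right_mono)
      finally show "ennreal ((L S)\<^sup>2) * emeasure lborel S \<le> ennreal (?a * (diameter (elt S) * jump_sum \<alpha> (elt S)))" .
    qed
    also have "\<dots> = ennreal (\<Sum>S\<in>\<S>. ?a * (diameter (elt S) * jump_sum \<alpha> (elt S)))"
      by (rule sum_ennreal) (intro mult_nonneg_nonneg a jump_sum_nonneg element_diameter(1) elt(1))
    also have "(\<Sum>S\<in>\<S>. ?a * (diameter (elt S) * jump_sum \<alpha> (elt S)))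
      = (\<Sum>T\<in>\<T>. real (card (simplices_of T)) * (?a * (diameter T * jump_sum \<alpha> T)))"
      unfolding sum_submesh by (rule sum.cong[OF refl]) (simp add: elt_eq)
    also have "ennreal \<dots> \<le> ennreal (\<Sum>T\<in>\<T>. 8 / \<rho> ^ 6 * (?a * (diameter T * jump_sum \<alpha> T)))"
      by (intro ennreal_leI sum_mono mult_right_mono card_simplices_of mult_nonneg_nonneg a jump_sum_nonneg element_diameter(1))
    also have "(\<Sum>T\<in>\<T>. 8 / \<rho> ^ 6 * (?a * (diameter T * jump_sum \<alpha> T)))
      = ?a * (8 / \<rho> ^ 6) * (\<Sum>T\<in>\<T>. diameter T * jump_sum \<alpha> T)"
      by (subst sum_distrib_left) (simp only: mult_ac)
    finally show ?thesis .
  qed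
  ultimately show ?thesis by blast
qed

lemma mesh_poincare:
  assumes K: "0 \<le> K" and poincare: "\<And>u e. energy_density \<Omega> u e \<Longrightarrow>
    \<exists>C. (\<integral>\<^sup>+x\<in>\<Omega>. ennreal ((u x - C)\<^sup>2) \<partial>lborel) \<le> ennreal K * (\<integral>\<^sup>+x\<in>\<Omega>. e x \<partial>lborel)"
  shows "\<exists>C. (\<Sum>T\<in>\<T>. diameter T ^ 3 * (\<Sum>V\<in>vertices_of \<V> T. (\<alpha> V - C)\<^sup>2))
    \<le> 2112 / (unit_ball_vol 3 * \<rho> ^ 6) * (K * (unit_ball_vol 3 / \<rho>\<^sup>2 * (32 / \<rho> ^ 6) ^ 4 * (8 / \<rho> ^ 6)))
      * (\<Sum>T\<in>\<T>. diameter T * (\<Sum>E\<in>edges_of \<E> T. \<bar>edge_jump \<tau> \<alpha> E\<bar>\<^sup>2))"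
proof -
  let ?c1 = "2112 / (unit_ball_vol 3 * \<rho> ^ 6)" and ?c2 = "unit_ball_vol 3 / \<rho>\<^sup>2 * (32 / \<rho> ^ 6) ^ 4 * (8 / \<rho> ^ 6)"
  let ?R = "\<Sum>T\<in>\<T>. diameter T * jump_sum \<alpha> T"
  obtain u where u: "u \<in> borel_measurable borel"
    "\<And>S. S \<in> \<S> \<Longrightarrow> \<exists>g c. linear g \<and> (\<forall>x\<in>S. u x = g x + c)"
    "\<And>S v. S \<in> \<S> \<Longrightarrow> v extreme_point_of S \<Longrightarrow> u v = vertex_value \<alpha> v"
    by (rule triangulation_interpolant[OF submesh_triangulation(1), where \<beta> = "vertex_value \<alpha>"]) blast
  obtain e where e: "energy_density \<Omega> u e" "(\<integral>\<^sup>+x\<in>\<Omega>. e x \<partial>lborel) \<le> ennreal (?c2 * ?R)"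
    using interpolant_energy[of u \<alpha>] u by blast
  obtain C where C: "(\<integral>\<^sup>+x\<in>\<Omega>. ennreal ((u x - C)\<^sup>2) \<partial>lborel) \<le> ennreal K * (\<integral>\<^sup>+x\<in>\<Omega>. e x \<partial>lborel)"
    using poincare[OF e(1)] by blast
  have R: "0 \<le> ?R" by (intro sum_nonneg mult_nonneg_nonneg element_diameter(1) jump_sum_nonneg)
  have c: "0 \<le> ?c1" "0 \<le> ?c2" using \<rho> by simp_all
  have "ennreal (\<Sum>T\<in>\<T>. diameter T ^ 3 * (\<Sum>V\<in>vertices_of \<V> T. (\<alpha> V - C)\<^sup>2))
    \<le> ennreal ?c1 * (\<integral>\<^sup>+x\<in>\<Omega>. ennreal ((u x - C)\<^sup>2) \<partial>lborel)"
    using u by (intro vertex_sum_le_integral)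
  also have "\<dots> \<le> ennreal ?c1 * (ennreal K * ennreal (?c2 * ?R))"
    by (intro mult_left_mono order_trans[OF C] e(2)) simp_all
  also have "\<dots> = ennreal (?c1 * (K * ?c2) * ?R)"
  proof -
    have eq: "ennreal p * (ennreal q * ennreal (s * t)) = ennreal (p * (q * s) * t)"
      if "0 \<le> p" "0 \<le> q" "0 \<le> s" "0 \<le> t" for p q s t
      using that by (simp add: ennreal_mult mult.assoc)
    show ?thesis by (rule eq[OF c(1) K c(2) R])
  qed
  finally have "(\<Sum>T\<in>\<T>. diameter T ^ 3 * (\<Sum>V\<in>vertices_of \<V> T. (\<alpha> V - C)\<^sup>2)) \<le> ?c1 * (K * ?c2) * ?R"
    by (rule iffD1[OF ennreal_le_iff[OF mult_nonneg_nonneg[OF mult_nonneg_nonneg[OF c(1) mult_nonneg_nonneg[OF K c(2)]] R]]])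
  then show ?thesis unfolding jump_sum_def by (rule exI)
qed

end

section \<open>The discrete Poincare inequality\<close>

theorem theorem4:
  fixes \<Omega> :: "(real ^ 3) set" and \<rho> :: real
  assumes "polytopal_set 3 \<Omega>" and "connected \<Omega>" and "0 < \<rho>"
  shows "\<exists>Cstar > 0. \<forall>\<T> \<F> \<E> \<V> \<tau>.
           polyhedral_mesh \<Omega> \<T> \<F> \<E> \<V> \<tau> \<and> mesh_regularity \<rho> \<Omega> \<T> \<F> \<V> \<longrightarrow>
           (\<forall>\<alpha> :: real ^ 3 \<Rightarrow> real. \<exists>C :: real.
              (\<Sum>T\<in>\<T>. diameter T ^ 3 * (\<Sum>V\<in>vertices_of \<V> T. (\<alpha> V - C)\<^sup>2))
              \<le> Cstar * (\<Sum>T\<in>\<T>. diameter T * (\<Sum>E\<in>edges_of \<E> T. \<bar>edge_jump \<tau> \<alpha> E\<bar>\<^sup>2)))"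
proof -
  have \<Omega>: "open \<Omega>" "\<Omega> \<noteq> {}"
    using polytopal_domain(1)[OF assms(1)] polytopal_set_facts(2)[OF assms(1)] by simp_all
  obtain \<D> where \<D>: "finite \<D>" "negligible (\<Omega> - \<Union>\<D>)"
    "\<forall>D\<in>\<D>. open D \<and> convex D \<and> bounded D \<and> D \<noteq> {} \<and> D \<subseteq> \<Omega>"
    using polytopal_domain(3)[OF assms(1)] by (elim exE conjE)
  have "\<exists>K>0. \<forall>u e. energy_density \<Omega> u e \<longrightarrow>
    (\<exists>C. (\<integral>\<^sup>+x\<in>\<Omega>. ennreal ((u x - C)\<^sup>2) \<partial>lborel) \<le> ennreal K * (\<integral>\<^sup>+x\<in>\<Omega>. e x \<partial>lborel))"
    by (rule poincare_inequality[OF \<Omega>(1) assms(2) \<Omega>(2) \<D>(1) _ \<D>(2)]) (rule bspec[OF \<D>(3)])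
  then obtain K where K: "0 < K" "\<forall>u e. energy_density \<Omega> u e \<longrightarrow>
    (\<exists>C. (\<integral>\<^sup>+x\<in>\<Omega>. ennreal ((u x - C)\<^sup>2) \<partial>lborel) \<le> ennreal K * (\<integral>\<^sup>+x\<in>\<Omega>. e x \<partial>lborel))"
    by (elim exE conjE)
  let ?c = "2112 / (unit_ball_vol 3 * \<rho> ^ 6)
    * (K * (unit_ball_vol 3 / \<rho>\<^sup>2 * (32 / \<rho> ^ 6) ^ 4 * (8 / \<rho> ^ 6)))"
  show ?thesis
  proof (rule exI[of _ ?c], intro conjI allI impI; (elim conjE)?)
    show "0 < ?c"
      using K(1) assms(3) by (intro mult_pos_pos divide_pos_pos zero_less_power) simp_all
    fix \<T> \<F> \<E> :: "(real^3) set set" and \<V> :: "(real^3) set" and \<tau> and \<alpha> :: "real^3 \<Rightarrow> real"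
    assume mesh: "polyhedral_mesh \<Omega> \<T> \<F> \<E> \<V> \<tau>" and regular: "mesh_regularity \<rho> \<Omega> \<T> \<F> \<V>"
    obtain \<S> where \<S>: "matching_submesh \<Omega> \<T> \<F> \<S>" "only_centers_added \<T> \<F> \<V> \<S>"
      "\<forall>S\<in>\<S>. \<rho> * diameter S \<le> inradius S"
      "\<forall>S\<in>\<S>. \<forall>T\<in>\<T>. interior S \<subseteq> T \<longrightarrow> \<rho> * diameter T \<le> diameter S"
      using regular unfolding mesh_regularity_def by (elim exE conjE)
    obtain c where c: "\<forall>Y\<in>\<T> \<union> \<F>. c Y \<in> Y" "\<V> \<subseteq> {v. \<exists>S\<in>\<S>. v extreme_point_of S}"
      "{v. \<exists>S\<in>\<S>. v extreme_point_of S} \<subseteq> \<V> \<union> c ` (\<T> \<union> \<F>)"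
      using \<S>(2) unfolding only_centers_added_def by (elim exE conjE)
    show "\<exists>C. (\<Sum>T\<in>\<T>. diameter T ^ 3 * (\<Sum>V\<in>vertices_of \<V> T. (\<alpha> V - C)\<^sup>2))
      \<le> ?c * (\<Sum>T\<in>\<T>. diameter T * (\<Sum>E\<in>edges_of \<E> T. \<bar>edge_jump \<tau> \<alpha> E\<bar>\<^sup>2))"
      by (rule mesh_poincare[OF mesh assms(1,3) \<S>(1) c \<S>(3,4) less_imp_le[OF K(1)]])
        (use K(2) in simp)
  qed
qed

end
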